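(* Let $d\ge1$ and $b\geq 1$ be integers and let $G$ be a connected $d$-regular graph. If $\lambda_{b+1}(G)<\psi(d,b)$, then $\tau(G)\geq\frac{1}{b}$, where $$\psi(d,b)=\begin{cases}\alpha_d & \text{if } d\le b+1,\\[2pt] \frac{d-2+\sqrt{d^2+4b+4}}{2} & \text{if } d\ge b+2 \text{ and } d, b \text{ have the same parity},\\[2pt] \frac{d-3+\sqrt{d^2+4b+2d+9}}{2} & \text{if } d\ge b+2 \text{ is odd and } b \text{ is even},\\[2pt] \frac{d-2+\sqrt{d^2+4b+8}}{2} & \text{if } d\ge b+2 \text{ is even and } b \text{ is odd},\end{cases}$$ and $\alpha_d$ is the largest root of $x^3-(d-2)x^2-2dx+d-1=0$.
   Context: All graphs are finite, simple and undirected. For a graph $G$ on $n$ vertices, $\lambda_1(G)\ge\lambda_2(G)\ge\cdots\ge\lambda_n(G)$ are the eigenvalues of its adjacency matrix. $c(G)$ denotes the number of connected components of $G$. The toughness of a non-complete graph $G$ is $\tau(G)=\min\{|S|/c(G-S): S \text{ is a vertex cut of } G\}$; $G$ is $t$-tough if $\tau(G)\ge t$ (a complete graph, having no vertex cut, is regarded as $t$-tough for every $t$). *)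

theory Defs
  imports
    Complex_Main
    "Jordan_Normal_Form.Char_Poly"
    "Graph_Theory.Graph_Theory"
begin

(* Finite simple undirected graphs are the instances of the locale graph of Graph_Theory:
   finite loop-free digraphs without parallel arcs whose arc relation is symmetric.
   An edge uv is thus the pair of arcs (u,v), (v,u), and the degree of v is its out-degree. *)

definition regular :: "nat \<Rightarrow> ('a, 'b) pre_digraph \<Rightarrow> bool" where
  "regular d G \<longleftrightarrow> (\<forall>v \<in> verts G. out_degree G v = d)"


(* The list vs enumerates the vertices, row and column i belonging to vs ! i. *)
definition adjacency_mat :: "('a, 'b) pre_digraph \<Rightarrow> 'a list \<Rightarrow> real mat" where
  "adjacency_mat G vs =
     mat (length vs) (length vs) (\<lambda>(i, j). if (vs ! i, vs ! j) \<in> arcs_ends G then 1 else 0)"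

(* Eigenvalues with multiplicity. Reordering the vertices conjugates the matrix by a permutation
   matrix, so the choice of enumeration does not matter; the matrix is real symmetric, so all
   roots of its characteristic polynomial are real. *)
definition graph_spectrum :: "('a, 'b) pre_digraph \<Rightarrow> real multiset" where
  "graph_spectrum G =
     proots (char_poly (adjacency_mat G (SOME vs. distinct vs \<and> set vs = verts G)))"

(* The i-th largest eigenvalue, counted from i = 1; meaningful for 1 \<le> i \<le> card (verts G)
   and unspecified otherwise. *)
definition graph_eigenvalue :: "('a, 'b) pre_digraph \<Rightarrow> nat \<Rightarrow> real" where
  "graph_eigenvalue G i = rev (sorted_list_of_multiset (graph_spectrum G)) ! (i - 1)"


definition delete_verts :: "('a, 'b) pre_digraph \<Rightarrow> 'a set \<Rightarrow> ('a, 'b) pre_digraph" where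
  "delete_verts G S = G \<restriction> (verts G - S)"

(* As arcs come in opposite pairs, the strongly connected components are the connected
   components. *)
definition num_components :: "('a, 'b) pre_digraph \<Rightarrow> nat" where
  "num_components G = card (pre_digraph.sccs G)"

(* "Disconnected" means at least two components, rather than the negation of connectedness:
   Graph_Theory regards the null graph as not connected, but S = verts G is no vertex cut. *)
definition vertex_cut :: "('a, 'b) pre_digraph \<Rightarrow> 'a set \<Rightarrow> bool" where
  "vertex_cut G S \<longleftrightarrow> S \<subseteq> verts G \<and> num_components (delete_verts G S) \<ge> 2"

(* Used for non-complete graphs only: these have a vertex cut, so the minimum is over a
   nonempty finite set. *)
definition toughness :: "('a, 'b) pre_digraph \<Rightarrow> real" where
  "toughness G = Min {real (card S) / real (num_components (delete_verts G S)) | S. vertex_cut G S}"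

definition tough :: "real \<Rightarrow> ('a, 'b) pre_digraph \<Rightarrow> bool" where
  "tough t G \<longleftrightarrow> complete_digraph (card (verts G)) G \<or> toughness G \<ge> t"


(* The largest real root; for d \<ge> 1 all three roots of the cubic are real. *)
definition alpha :: "nat \<Rightarrow> real" where
  "alpha d = Max {x::real. x ^ 3 - (real d - 2) * x ^ 2 - 2 * real d * x + real d - 1 = 0}"

definition psi :: "nat \<Rightarrow> nat \<Rightarrow> real" where
  "psi d b =
     (if d \<le> b + 1 then alpha d
      else if even d \<longleftrightarrow> even b then
        (real d - 2 + sqrt (real d ^ 2 + 4 * real b + 4)) / 2
      else if odd d then
        (real d - 3 + sqrt (real d ^ 2 + 4 * real b + 2 * real d + 9)) / 2
      else
        (real d - 2 + sqrt (real d ^ 2 + 4 * real b + 8)) / 2)"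

end

theory Submission
  imports Defs
begin

text \<open>Suppose that \<open>G - S\<close> has more than \<open>b |S|\<close> components. At most \<open>d |S|\<close> edges leave \<open>S\<close>, and
  counting them forces \<open>b < d\<close> and yields \<open>b + 1\<close> components that send between 1 and \<open>d - b\<close>
  edges to \<open>S\<close>. Such a component \<open>C\<close> has at least \<open>d + 1\<close> vertices. If \<open>u v\<close> is the number
  of neighbours of \<open>v\<close> in \<open>S\<close>, \<open>e\<close> is the sum of \<open>u\<close> over \<open>C\<close> and \<open>g = \<theta> + 1 + |C| - d\<close>, then
  evaluating the adjacency form at the vector \<open>g - u\<close> gives a Rayleigh quotient of at least
  \<open>\<theta>\<close> as soon as \<open>e \<le> (d - \<theta>) g\<close>. The branches of \<open>\<psi>\<close> solve this as an equation for the smallest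
  \<open>|C|\<close> and the largest \<open>e\<close> allowed by the parity of \<open>d |C| - e\<close>; only for \<open>d = b + 1\<close> and
  \<open>|C| = d + 2\<close> is the estimate too weak, and there \<open>\<alpha>\<^sub>d\<close> is an eigenvalue of \<open>C\<close>. No arcs join different
  components, so \<open>b + 1\<close> test vectors give \<open>\<psi> \<le> \<lambda>\<^bsub>b+1\<^esub>\<close> by the Courant-Fischer principle.\<close>

section \<open>Eigenvalues of real symmetric matrices\<close>

lemma scalar_prod_self_pos:
  fixes v :: "real vec"
  assumes "v \<in> carrier_vec n" "v \<noteq> 0\<^sub>v n"
  shows "0 < v \<bullet> v"
  using conjugate_square_greater_0_vec[OF assms(1)] assms(2) by (simp add: scalar_prod_def)

text \<open>Over the complex numbers an eigenvalue \<open>z\<close> exists. Symmetry forces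
  \<open>z\<close> to be real, so the real and imaginary parts of a complex eigenvector satisfy the
  eigenvector equation themselves, and one of them is nonzero.\<close>

lemma symmetric_mat_real_eigenvector:
  fixes A :: "real mat"
  assumes A: "A \<in> carrier_mat n n" and sym: "transpose_mat A = A" and "0 < n"
  obtains v a where "v \<in> carrier_vec n" "v \<noteq> 0\<^sub>v n" "A *\<^sub>v v = a \<cdot>\<^sub>v v"
proof -
  define C where "C = map_mat complex_of_real A"
  have C: "C \<in> carrier_mat n n" using A by (simp add: C_def)
  obtain as where as: "char_poly C = (\<Prod>a\<leftarrow>as. [:- a, 1:])" "length as = n"
    using char_poly_factorized[OF C] by auto
  then obtain z where "z \<in> set as" using \<open>0 < n\<close> by (cases as) auto
  then have "poly (char_poly C) z = 0" by (auto simp: as(1) poly_prod_list prod_list_zero_iff)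
  then obtain v where v: "eigenvector C v z"
    using eigenvalue_root_char_poly[OF C] by (auto simp: eigenvalue_def)
  have vc: "v \<in> carrier_vec n" and v0: "v \<noteq> 0\<^sub>v n" and Cv: "C *\<^sub>v v = z \<cdot>\<^sub>v v"
    using v C by (auto simp: eigenvector_def)
  define x where "x = map_vec Re v"
  define y where "y = map_vec Im v"
  have x: "x \<in> carrier_vec n" and y: "y \<in> carrier_vec n" using vc by (auto simp: x_def y_def)
  have entry: "(\<Sum>j = 0..<n. complex_of_real (A $$ (i, j)) * v $ j) = z * v $ i" if "i < n" for i
    using arg_cong[OF Cv, of "\<lambda>u. u $ i"] that A C vc by (simp add: scalar_prod_def C_def)
  have Ax: "A *\<^sub>v x = Re z \<cdot>\<^sub>v x - Im z \<cdot>\<^sub>v y"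
  proof (rule eq_vecI)
    fix i assume "i < dim_vec (Re z \<cdot>\<^sub>v x - Im z \<cdot>\<^sub>v y)"
    then have i: "i < n" using y by simp
    from arg_cong[OF entry[OF i], of Re]
    show "(A *\<^sub>v x) $ i = (Re z \<cdot>\<^sub>v x - Im z \<cdot>\<^sub>v y) $ i"
      using i A vc by (simp add: scalar_prod_def x_def y_def)
  qed (use A y in auto)
  have Ay: "A *\<^sub>v y = Im z \<cdot>\<^sub>v x + Re z \<cdot>\<^sub>v y"
  proof (rule eq_vecI)
    fix i assume "i < dim_vec (Im z \<cdot>\<^sub>v x + Re z \<cdot>\<^sub>v y)"
    then have i: "i < n" using y by simp
    from arg_cong[OF entry[OF i], of Im]
    show "(A *\<^sub>v y) $ i = (Im z \<cdot>\<^sub>v x + Re z \<cdot>\<^sub>v y) $ i"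
      using i A vc by (simp add: scalar_prod_def x_def y_def algebra_simps)
  qed (use A y in auto)
  \<comment> \<open>After expansion the terms \<open>Re z * (y \<bullet> x)\<close> cancel, which
    leaves \<open>Im z\<close> times a positive sum of squares.\<close>
  have "y \<bullet> (A *\<^sub>v x) = (A *\<^sub>v y) \<bullet> x"
    using transpose_vec_mult_scalar[OF A x y] sym by simp
  then have "Re z * (y \<bullet> x) - Im z * (y \<bullet> y) = Im z * (x \<bullet> x) + Re z * (y \<bullet> x)"
    using x y unfolding Ax Ay
    by (simp add: scalar_prod_minus_distrib[of _ n] add_scalar_prod_distrib[of _ n])
  then have im: "Im z * (x \<bullet> x + y \<bullet> y) = 0" by (simp add: algebra_simps)
  have xy0: "x \<noteq> 0\<^sub>v n \<or> y \<noteq> 0\<^sub>v n"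
  proof (rule ccontr)
    assume "\<not> ?thesis"
    then have h: "x $ i = 0" "y $ i = 0" if "i < n" for i using that by auto
    have "v = 0\<^sub>v n"
      by (rule eq_vecI) (use h vc in \<open>auto simp: x_def y_def complex_eq_iff\<close>)
    then show False using v0 by simp
  qed
  have "0 \<le> x \<bullet> x" "0 \<le> y \<bullet> y" by (auto simp: scalar_prod_def intro!: sum_nonneg)
  moreover have "0 < x \<bullet> x \<or> 0 < y \<bullet> y"
    using xy0 scalar_prod_self_pos x y by blast
  ultimately have "Im z = 0" using im by auto
  then have "A *\<^sub>v x = Re z \<cdot>\<^sub>v x" "A *\<^sub>v y = Re z \<cdot>\<^sub>v y"
    using x y unfolding Ax Ay by auto
  then show thesis using that x y xy0 by blast
qed

text \<open>The Householder reflection exchanging \<open>v\<close> and the first unit vector. If they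
  coincide, then \<open>w = 0\<close>, and \<open>2 / 0 = 0\<close> makes the matrix below the identity.\<close>

lemma householder_reflection:
  fixes v :: "real vec"
  assumes v: "v \<in> carrier_vec n" and unit: "v \<bullet> v = 1" and n: "0 < n"
  obtains H where "H \<in> carrier_mat n n" "transpose_mat H = H" "H * H = 1\<^sub>m n"
    "H *\<^sub>v unit_vec n 0 = v"
proof -
  define w where "w = v - unit_vec n 0"
  define c where "c = 2 / (w \<bullet> w)"
  define H where "H = mat n n (\<lambda>(i, j). (if i = j then 1 else 0) - c * w $ i * w $ j)"
  have w: "w \<in> carrier_vec n" using v by (simp add: w_def)
  have ww: "w \<bullet> w = 2 - 2 * v $ 0"
    using v unit n unfolding w_def
    by (simp add: scalar_prod_minus_distrib[of _ n] minus_scalar_prod_distrib[of _ n])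
  \<comment> \<open>In this form the identity also holds for \<open>w \<bullet> w = 0\<close>, where
    \<open>c = 0\<close>; it is what makes \<open>H\<close> an involution.\<close>
  have c: "c * (c * (w \<bullet> w)) = 2 * c" by (simp add: c_def)
  have "(\<Sum>k = 0..<n. ((if i = k then 1 else 0) - c * w $ i * w $ k) * ((if k = j then 1 else 0) - c * w $ k * w $ j))
      = (if i = j then 1 else 0)" if "i < n" "j < n" for i j
  proof -
    have "(\<Sum>k = 0..<n. ((if i = k then 1 else 0) - c * w $ i * w $ k) * ((if k = j then 1 else 0) - c * w $ k * w $ j))
      = (\<Sum>k = 0..<n. (if i = k then if k = j then 1 else 0 else 0) - (if i = k then c * w $ k * w $ j else 0)
          - (if k = j then c * w $ i * w $ k else 0) + c * c * w $ i * w $ j * (w $ k * w $ k))"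
      by (intro sum.cong) (auto simp: algebra_simps)
    also have "\<dots> = (if i = j then 1 else 0) - c * w $ i * w $ j - c * w $ i * w $ j
        + c * c * w $ i * w $ j * (w \<bullet> w)"
      using that w by (simp add: sum.distrib sum_subtractf sum_distrib_left[symmetric] scalar_prod_def)
    also have "\<dots> = (if i = j then 1 else 0) + w $ i * w $ j * (c * (c * (w \<bullet> w)) - 2 * c)"
      by (simp add: algebra_simps)
    finally show ?thesis using c by simp
  qed
  then have "H * H = 1\<^sub>m n"
    by (intro eq_matI) (auto simp: H_def scalar_prod_def)
  moreover have "H *\<^sub>v unit_vec n 0 = v"
  proof (rule eq_vecI)
    fix i assume "i < dim_vec v"
    then have i: "i < n" using v by simp
    have "(H *\<^sub>v unit_vec n 0) $ i = (if i = 0 then 1 else 0) - c * w $ i * w $ 0"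
      using i n by (simp add: H_def)
    also have "\<dots> = v $ i"
    proof (cases "w \<bullet> w = 0")
      case True
      then have "w = 0\<^sub>v n" using scalar_prod_self_pos[OF w] by fastforce
      then have "w $ i = 0" using i by simp
      then show ?thesis using i v n by (auto simp: w_def split: if_splits)
    next
      case False
      \<comment> \<open>Together with \<open>ww\<close> this gives
        \<open>w \<bullet> w = - 2 * w $ 0\<close>.\<close>
      have "w $ 0 = v $ 0 - 1" using n v by (simp add: w_def)
      then have "c * w $ 0 = - 1" using False unfolding c_def ww by (simp add: field_simps)
      then have "c * w $ i * w $ 0 = - w $ i" by (metis mult.commute mult.left_commute mult_minus1)
      then show ?thesis using i v n by (auto simp: w_def split: if_splits)
    qed
    finally show "(H *\<^sub>v unit_vec n 0) $ i = v $ i" .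
  qed (use v in \<open>auto simp: H_def\<close>)
  moreover have "H \<in> carrier_mat n n" "transpose_mat H = H"
    by (auto simp: H_def intro!: eq_matI)
  ultimately show thesis using that by blast
qed

text \<open>Induction on the dimension. Conjugation by a reflection that takes the first unit vector
  to a unit eigenvector turns \<open>A\<close> into a block matrix with diagonal blocks
  \<open>a\<close> and \<open>C\<close>, and the induction hypothesis diagonalizes
  \<open>C\<close>.\<close>

theorem symmetric_mat_orthogonal_diagonalization:
  fixes A :: "real mat"
  assumes "A \<in> carrier_mat n n" "transpose_mat A = A"
  shows "\<exists>P f. P \<in> carrier_mat n n \<and> P * transpose_mat P = 1\<^sub>m n \<and> A = P * mat_diag n f * transpose_mat P"
  using assms
proof (induction n arbitrary: A)
  case 0
  show ?case
    by (rule exI[of _ "1\<^sub>m 0"], rule exI[of _ "\<lambda>_. 0"]) (use 0 in \<open>auto intro!: eq_matI\<close>)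
next
  case (Suc m)
  let ?n = "Suc m" let ?e = "unit_vec ?n 0 :: real vec"
  note A = Suc.prems(1) and sym = Suc.prems(2)
  obtain u a where u: "u \<in> carrier_vec ?n" "u \<noteq> 0\<^sub>v ?n" and Au: "A *\<^sub>v u = a \<cdot>\<^sub>v u"
    using symmetric_mat_real_eigenvector[OF A sym] by auto
  define v where "v = (1 / sqrt (u \<bullet> u)) \<cdot>\<^sub>v u"
  have v: "v \<in> carrier_vec ?n" using u by (simp add: v_def)
  have Av: "A *\<^sub>v v = a \<cdot>\<^sub>v v"
    using Au A u by (simp add: v_def mult_mat_vec smult_smult_assoc mult.commute)
  have "v \<bullet> v = 1" using scalar_prod_self_pos[OF u] u by (simp add: v_def)
  then obtain H where H: "H \<in> carrier_mat ?n ?n" "transpose_mat H = H" "H * H = 1\<^sub>m ?n" "H *\<^sub>v ?e = v"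
    using householder_reflection[OF v] by auto
  have Hv: "H *\<^sub>v v = ?e"
    using H(1,3) assoc_mult_mat_vec[OF H(1) H(1), of ?e] unfolding H(4)[symmetric] by simp
  define B where "B = H * A * H"
  have B: "B \<in> carrier_mat ?n ?n" using H A by (simp add: B_def)
  have Bsym: "transpose_mat B = B"
    using H A sym unfolding B_def by (simp add: transpose_mult[of _ ?n ?n _ ?n] assoc_mult_mat[of _ ?n ?n _ ?n _ ?n])
  have Be: "B *\<^sub>v ?e = a \<cdot>\<^sub>v ?e"
    using H A v Hv Av unfolding B_def
    by (simp add: assoc_mult_mat_vec[of _ ?n ?n _ ?n] mult_mat_vec)
  have Bcol: "B $$ (i, 0) = (if i = 0 then a else 0)" if "i < ?n" for i
    using arg_cong[OF Be, of "\<lambda>x. x $ i"] that B by simp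
  \<comment> \<open>The eigenvector equation fixes the first column; symmetry carries it over to the
    first row, which splits \<open>B\<close> into blocks.\<close>
  have Brow: "B $$ (0, i) = (if i = 0 then a else 0)" if "i < ?n" for i
  proof -
    have "B $$ (0, i) = transpose_mat B $$ (i, 0)" using B that by simp
    then show ?thesis using Bsym Bcol that by simp
  qed
  define C where "C = mat m m (\<lambda>(i, j). B $$ (Suc i, Suc j))"
  have C: "C \<in> carrier_mat m m" by (simp add: C_def)
  have Csym: "transpose_mat C = C"
  proof (rule eq_matI)
    fix i j assume "i < dim_row C" "j < dim_col C"
    then have ij: "i < m" "j < m" using C by auto
    have "B $$ (Suc j, Suc i) = transpose_mat B $$ (Suc i, Suc j)" using B ij by simp
    then show "transpose_mat C $$ (i, j) = C $$ (i, j)" using ij Bsym by (simp add: C_def)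
  qed (use C in auto)
  obtain R f where R: "R \<in> carrier_mat m m" "R * transpose_mat R = 1\<^sub>m m"
      and Cd: "C = R * mat_diag m f * transpose_mat R"
    using Suc.IH[OF C Csym] by auto
  define g where "g i = (case i of 0 \<Rightarrow> a | Suc j \<Rightarrow> f j)" for i
  let ?a = "mat 1 1 (\<lambda>_. a)"
  define Q where "Q = four_block_mat (1\<^sub>m 1) (0\<^sub>m 1 m) (0\<^sub>m m 1) R"
  have Q: "Q \<in> carrier_mat ?n ?n" using R(1) four_block_carrier_mat[of "1\<^sub>m 1" 1 1 R m m] by (simp add: Q_def)
  have QT: "transpose_mat Q = four_block_mat (1\<^sub>m 1) (0\<^sub>m 1 m) (0\<^sub>m m 1) (transpose_mat R)"
    using R(1) unfolding Q_def by (subst transpose_four_block_mat) auto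
  have D: "mat_diag ?n g = four_block_mat ?a (0\<^sub>m 1 m) (0\<^sub>m m 1) (mat_diag m f)"
    by (rule eq_matI) (auto simp: mat_diag_def g_def split: nat.splits)
  have BC: "B = four_block_mat ?a (0\<^sub>m 1 m) (0\<^sub>m m 1) C"
    by (rule eq_matI) (use B Bcol Brow in \<open>auto simp: C_def\<close>)
  have QQ: "Q * transpose_mat Q = 1\<^sub>m ?n"
    unfolding QT unfolding Q_def
    by (subst mult_four_block_mat[of _ 1 1 _ m _ m _ _ 1 _ m]) (use R in auto)
  have RD: "R * mat_diag m f \<in> carrier_mat m m" using R(1) by simp
  have zD: "0\<^sub>m 1 m * mat_diag m f = 0\<^sub>m 1 m"
    by (rule left_mult_zero_mat) simp
  have Dz: "R * mat_diag m f * 0\<^sub>m m 1 = 0\<^sub>m m 1"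
    using RD by (rule right_mult_zero_mat)
  have RDR: "R * mat_diag m f * transpose_mat R \<in> carrier_mat m m"
    using R(1) by (intro mult_carrier_mat[OF RD]) simp
  have QD: "Q * mat_diag ?n g = four_block_mat ?a (0\<^sub>m 1 m) (0\<^sub>m m 1) (R * mat_diag m f)"
    unfolding D Q_def
    by (subst mult_four_block_mat[of _ 1 1 _ m _ m _ _ 1 _ m]) (use R zD in auto)
  have QDQ: "Q * mat_diag ?n g * transpose_mat Q = B"
    unfolding QD QT BC Cd
    by (subst mult_four_block_mat[of _ 1 1 _ m _ m _ _ 1 _ m]) (use R RD Dz RDR in auto)
  define P where "P = H * Q"
  have P: "P \<in> carrier_mat ?n ?n" using H Q by (simp add: P_def)
  have PT: "transpose_mat P = transpose_mat Q * H"
    using H Q by (simp add: P_def transpose_mult[of _ ?n ?n _ ?n])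
  have QTc: "transpose_mat Q \<in> carrier_mat ?n ?n" using Q by simp
  have "P * transpose_mat P = H * (Q * transpose_mat Q) * H"
    using H(1) Q QTc unfolding PT unfolding P_def by (simp add: assoc_mult_mat[of _ ?n ?n _ ?n _ ?n])
  then have "P * transpose_mat P = 1\<^sub>m ?n" using QQ H by simp
  moreover have "mat_diag ?n g * transpose_mat Q \<in> carrier_mat ?n ?n"
    by (intro mult_carrier_mat[OF _ QTc]) simp
  then have "P * mat_diag ?n g * transpose_mat P = H * (Q * mat_diag ?n g * transpose_mat Q) * H"
    using H(1) Q QTc unfolding PT unfolding P_def by (simp add: assoc_mult_mat[of _ ?n ?n _ ?n _ ?n])
  moreover have "H * B * H = (H * H) * A * (H * H)"
    using H(1) A unfolding B_def by (simp add: assoc_mult_mat[of _ ?n ?n _ ?n _ ?n])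
  ultimately show ?case using P QDQ H A by (intro exI[of _ P] exI[of _ g]) auto
qed

section \<open>Counting eigenvalues with test vectors\<close>

lemma homogeneous_system_nontrivial:
  fixes M :: "'i \<Rightarrow> nat \<Rightarrow> real"
  assumes "finite I" "card I < k"
  obtains c where "\<exists>j<k. c j \<noteq> 0" "\<And>i. i \<in> I \<Longrightarrow> (\<Sum>j<k. c j * M i j) = 0"
proof -
  obtain h where h: "bij_betw h {..<card I} I"
    using ex_bij_betw_nat_finite[OF \<open>finite I\<close>] by (auto simp: atLeast0LessThan)
  \<comment> \<open>Zero rows pad the system to a square one. One of them has index
    \<open>card I < k\<close>, so the transpose annihilates the unit vector at that index and the
    determinant vanishes.\<close>
  define N where "N = mat k k (\<lambda>(i, j). if i < card I then M (h i) j else 0)"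
  have N: "N \<in> carrier_mat k k" by (simp add: N_def)
  have "det N = 0"
  proof -
    have "transpose_mat N *\<^sub>v unit_vec k (card I) = 0\<^sub>v k"
      by (rule eq_vecI) (use assms in \<open>auto simp: N_def\<close>)
    moreover have "unit_vec k (card I) \<noteq> (0\<^sub>v k :: real vec)" using assms by simp
    ultimately have "det (transpose_mat N) = 0"
      using det_0_iff_vec_prod_zero[of "transpose_mat N" k] N by force
    then show ?thesis using N by (simp add: det_transpose)
  qed
  then obtain v where v: "v \<in> carrier_vec k" "v \<noteq> 0\<^sub>v k" "N *\<^sub>v v = 0\<^sub>v k"
    using det_0_iff_vec_prod_zero[OF N] by auto
  have "\<exists>j<k. v $ j \<noteq> 0"
  proof (rule ccontr)
    assume "\<not> ?thesis"
    then have "v = 0\<^sub>v k" using v(1) by (intro eq_vecI) auto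
    then show False using v(2) by simp
  qed
  moreover have "(\<Sum>j<k. v $ j * M i j) = 0" if "i \<in> I" for i
  proof -
    obtain a where a: "a < card I" "i = h a" using h \<open>i \<in> I\<close> by (auto simp: bij_betw_def)
    then have "(N *\<^sub>v v) $ a = 0" using v(3) assms by simp
    then show ?thesis
      using a assms v(1) by (simp add: N_def scalar_prod_def atLeast0LessThan mult.commute)
  qed
  ultimately show thesis using that[of "\<lambda>j. v $ j"] by blast
qed

text \<open>The easy half of the Courant-Fischer principle, for a subspace spanned by vectors
  that are orthogonal with respect to both forms.\<close>

theorem count_eigenvalues_ge:
  fixes A :: "real mat" and x :: "nat \<Rightarrow> real vec"
  assumes A: "A \<in> carrier_mat n n" and sym: "transpose_mat A = A"
    and x: "\<And>i. i < k \<Longrightarrow> x i \<in> carrier_vec n" "\<And>i. i < k \<Longrightarrow> x i \<noteq> 0\<^sub>v n"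
    and orth: "\<And>i j. i < k \<Longrightarrow> j < k \<Longrightarrow> i \<noteq> j \<Longrightarrow> x i \<bullet> x j = 0"
    and orthA: "\<And>i j. i < k \<Longrightarrow> j < k \<Longrightarrow> i \<noteq> j \<Longrightarrow> x i \<bullet> (A *\<^sub>v x j) = 0"
    and ge: "\<And>i. i < k \<Longrightarrow> \<theta> * (x i \<bullet> x i) \<le> x i \<bullet> (A *\<^sub>v x i)"
  shows "k \<le> size (filter_mset (\<lambda>e. \<theta> \<le> e) (proots (char_poly A)))"
proof (rule ccontr)
  assume "\<not> ?thesis"
  then have small: "size (filter_mset (\<lambda>e. \<theta> \<le> e) (proots (char_poly A))) < k" by simp
  obtain P f where P: "P \<in> carrier_mat n n" "P * transpose_mat P = 1\<^sub>m n"
    and Ad: "A = P * mat_diag n f * transpose_mat P"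
    using symmetric_mat_orthogonal_diagonalization[OF A sym] by auto
  have PT: "transpose_mat P \<in> carrier_mat n n" using P(1) by simp
  have PTP: "transpose_mat P * P = 1\<^sub>m n" using mat_mult_left_right_inverse[OF P(1) PT P(2)] .
  have "similar_mat A (mat_diag n f)"
    unfolding similar_mat_def similar_mat_wit_def Let_def
    by (rule exI[of _ P], rule exI[of _ "transpose_mat P"]) (use A P PT PTP Ad in auto)
  then have "char_poly A = char_poly (mat_diag n f)" by (rule char_poly_similar)
  also have "\<dots> = (\<Prod>a\<leftarrow>diag_mat (mat_diag n f). [:- a, 1:])"
    by (rule char_poly_upper_triangular[of _ n]) (auto simp: mat_diag_def)
  also have "diag_mat (mat_diag n f) = map f [0..<n]"
    by (auto simp: diag_mat_def mat_diag_def)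
  finally have cp: "char_poly A = (\<Prod>a\<leftarrow>map f [0..<n]. [:- a, 1:])" .
  have "proots (\<Prod>a\<leftarrow>es. [:- a, 1:]) = mset es" for es :: "real list"
  proof (induction es)
    case (Cons a es)
    have "(\<Prod>a\<leftarrow>es. [:- a, 1:]) \<noteq> 0" by (auto simp: prod_list_zero_iff)
    then have "proots ([:- a, 1:] * (\<Prod>a\<leftarrow>es. [:- a, 1:])) = {#a#} + mset es"
      by (subst proots_mult) (simp_all add: Cons.IH)
    then show ?case by simp
  qed simp
  then have roots: "proots (char_poly A) = mset (map f [0..<n])" unfolding cp .
  define I where "I = {i. i < n \<and> \<theta> \<le> f i}"
  have "size (filter_mset (\<lambda>e. \<theta> \<le> e) (mset (map f [0..<n]))) = length (filter (\<lambda>e. \<theta> \<le> e) (map f [0..<n]))"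
    by (metis mset_filter size_mset)
  also have "\<dots> = length (filter (\<lambda>i. \<theta> \<le> f i) [0..<n])"
    by (simp add: filter_map comp_def)
  also have "\<dots> = card I" unfolding I_def length_filter_conv_card by (rule arg_cong[of _ _ card]) auto
  finally have cardI: "card I < k" using small roots by simp
  have finI: "finite I" by (simp add: I_def)
  \<comment> \<open>The vector \<open>z a\<close> holds the coordinates of \<open>x a\<close> in an
    orthonormal eigenbasis, where both forms become weighted sums over the coordinates.\<close>
  define z where "z a = transpose_mat P *\<^sub>v x a" for a
  define y where "y a i = z a $ i" for a i
  have z: "z a \<in> carrier_vec n" if "a < k" for a using PT x(1)[OF that] by (simp add: z_def)
  have xx: "x a \<bullet> x b = (\<Sum>i<n. y a i * y b i)" if ab: "a < k" "b < k" for a b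
  proof -
    have "(\<Sum>i<n. y a i * y b i) = (z a) \<bullet> (z b)"
      using z[OF ab(2)] by (simp add: y_def scalar_prod_def atLeast0LessThan)
    also have "\<dots> = x a \<bullet> (P *\<^sub>v (z b))"
      unfolding z_def[of a] by (rule transpose_vec_mult_scalar[OF P(1) z[OF ab(2)] x(1)[OF ab(1)]])
    also have "P *\<^sub>v (z b) = x b"
      using assoc_mult_mat_vec[OF P(1) PT x(1)[OF ab(2)]] P(2) x(1)[OF ab(2)] by (simp add: z_def)
    finally show ?thesis ..
  qed
  have xAx: "x a \<bullet> (A *\<^sub>v x b) = (\<Sum>i<n. f i * (y a i * y b i))" if ab: "a < k" "b < k" for a b
  proof -
    have D: "mat_diag n f \<in> carrier_mat n n" by simp
    have Dy: "mat_diag n f *\<^sub>v (z b) = vec n (\<lambda>i. f i * y b i)"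
    proof (rule eq_vecI)
      fix i assume "i < dim_vec (vec n (\<lambda>i. f i * y b i))"
      then have i: "i < n" by simp
      have "row (mat_diag n f) i = f i \<cdot>\<^sub>v unit_vec n i"
        using i by (intro eq_vecI) (auto simp: mat_diag_def)
      then show "(mat_diag n f *\<^sub>v (z b)) $ i = vec n (\<lambda>i. f i * y b i) $ i"
        using i z[OF ab(2)] carrier_matD(1)[OF D] by (simp add: y_def)
    qed (simp add: mat_diag_def)
    have "A *\<^sub>v x b = P *\<^sub>v (mat_diag n f *\<^sub>v (z b))"
      using P PT x(1)[OF ab(2)] D unfolding Ad z_def by (simp add: assoc_mult_mat_vec[of _ n n _ n])
    also have "\<dots> = P *\<^sub>v vec n (\<lambda>i. f i * y b i)" unfolding Dy ..
    finally have "x a \<bullet> (A *\<^sub>v x b) = (z a) \<bullet> vec n (\<lambda>i. f i * y b i)"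
      using transpose_vec_mult_scalar[OF P(1) _ x(1)[OF ab(1)], of "vec n (\<lambda>i. f i * y b i)"] by (simp add: z_def)
    also have "\<dots> = (\<Sum>i<n. f i * (y a i * y b i))"
      using z[OF ab(1)] by (simp add: y_def scalar_prod_def atLeast0LessThan mult.left_commute)
    finally show ?thesis .
  qed
  \<comment> \<open>There are fewer conditions than unknowns, so some nontrivial combination of the
    \<open>k\<close> vectors involves only eigenvalues below \<open>\<theta>\<close>.\<close>
  obtain c where c: "\<exists>a<k. c a \<noteq> 0" and cI: "\<And>i. i \<in> I \<Longrightarrow> (\<Sum>a<k. c a * y a i) = 0"
    using homogeneous_system_nontrivial[OF finI cardI, of "\<lambda>i a. y a i"] by auto
  define w where "w i = (\<Sum>a<k. c a * y a i)" for i
  \<comment> \<open>Orthogonality removes the cross terms. The choice \<open>h = 1\<close> gives the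
    norm, \<open>h = f\<close> the quadratic form.\<close>
  have diag: "(\<Sum>i<n. h i * (w i)\<^sup>2) = (\<Sum>a<k. (c a)\<^sup>2 * (\<Sum>i<n. h i * (y a i * y a i)))"
    if "\<And>a b. a < k \<Longrightarrow> b < k \<Longrightarrow> a \<noteq> b \<Longrightarrow> (\<Sum>i<n. h i * (y a i * y b i)) = 0" for h :: "nat \<Rightarrow> real"
  proof -
    have "(\<Sum>i<n. h i * (w i)\<^sup>2) = (\<Sum>i<n. \<Sum>a<k. \<Sum>b<k. c a * c b * (h i * (y a i * y b i)))"
      unfolding w_def power2_eq_square sum_product sum_distrib_left
      by (intro sum.cong refl) (simp add: sum_distrib_left mult_ac)
    also have "\<dots> = (\<Sum>a<k. \<Sum>b<k. c a * c b * (\<Sum>i<n. h i * (y a i * y b i)))"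
      unfolding sum_distrib_left
      by (subst sum.swap, rule sum.cong[OF refl], rule sum.swap)
    also have "\<dots> = (\<Sum>a<k. \<Sum>b<k. if b = a then c a * c b * (\<Sum>i<n. h i * (y a i * y b i)) else 0)"
      by (intro sum.cong refl) (use that in auto)
    also have "\<dots> = (\<Sum>a<k. (c a)\<^sup>2 * (\<Sum>i<n. h i * (y a i * y a i)))"
      by (intro sum.cong refl) (simp add: power2_eq_square)
    finally show ?thesis .
  qed
  have norm: "(\<Sum>i<n. (w i)\<^sup>2) = (\<Sum>a<k. (c a)\<^sup>2 * (x a \<bullet> x a))"
    using diag[of "\<lambda>_. 1"] orth by (simp add: xx)
  have form: "(\<Sum>i<n. f i * (w i)\<^sup>2) = (\<Sum>a<k. (c a)\<^sup>2 * (x a \<bullet> (A *\<^sub>v x a)))"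
    using diag[of f] orthA by (simp add: xAx)
  have "\<theta> * (\<Sum>i<n. (w i)\<^sup>2) \<le> (\<Sum>i<n. f i * (w i)\<^sup>2)"
    unfolding form norm sum_distrib_left using ge
    by (intro sum_mono) (metis lessThan_iff mult.left_commute mult_left_mono zero_le_power2)
  then have nonneg: "0 \<le> (\<Sum>i<n. (f i - \<theta>) * (w i)\<^sup>2)"
    by (simp add: sum_distrib_left sum_subtractf algebra_simps)
  \<comment> \<open>Nonpositive summands with a nonnegative sum all vanish. Outside \<open>I\<close>
    the factor \<open>f i - \<theta>\<close> is negative, so \<open>w\<close> is zero everywhere,
    against its positive norm.\<close>
  have np: "(f i - \<theta>) * (w i)\<^sup>2 \<le> 0" if "i < n" for i
    using that cI[of i] by (cases "i \<in> I") (auto simp: w_def I_def mult_le_0_iff)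
  have zero: "w i = 0" if i: "i < n" for i
  proof (cases "i \<in> I")
    case False
    have "(\<Sum>j<n. - ((f j - \<theta>) * (w j)\<^sup>2)) = 0"
    proof (rule antisym)
      show "(\<Sum>j<n. - ((f j - \<theta>) * (w j)\<^sup>2)) \<le> 0" using nonneg by (simp add: sum_negf)
      show "0 \<le> (\<Sum>j<n. - ((f j - \<theta>) * (w j)\<^sup>2))" using np by (intro sum_nonneg) auto
    qed
    then have "(f i - \<theta>) * (w i)\<^sup>2 = 0"
      using sum_nonneg_eq_0_iff[of "{..<n}" "\<lambda>j. - ((f j - \<theta>) * (w j)\<^sup>2)"] np i by auto
    then show ?thesis using False i by (auto simp: I_def)
  qed (use cI in \<open>simp add: w_def\<close>)
  have "0 < (\<Sum>a<k. (c a)\<^sup>2 * (x a \<bullet> x a))"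
  proof -
    obtain a where a: "a < k" "c a \<noteq> 0" using c by auto
    have "0 \<le> x b \<bullet> x b" for b by (auto simp: scalar_prod_def intro!: sum_nonneg)
    moreover have "0 < x a \<bullet> x a" using scalar_prod_self_pos x a by blast
    ultimately show ?thesis using a by (intro sum_pos2[of _ a]) auto
  qed
  then show False using zero norm by simp
qed

text \<open>If entry \<open>k\<close> were below \<open>\<theta>\<close>, so would be all later
  ones, and only the \<open>k\<close> entries before it could reach \<open>\<theta>\<close>.\<close>

lemma nth_descending_ge:
  fixes xs :: "real list"
  assumes "sorted_wrt (\<ge>) xs" and "k < length (filter (\<lambda>e. \<theta> \<le> e) xs)"
  shows "\<theta> \<le> xs ! k"
proof (rule ccontr)
  assume neg: "\<not> ?thesis"
  have "k < length xs" using assms(2) length_filter_le[of "\<lambda>e. \<theta> \<le> e" xs] by linarith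
  have "filter (\<lambda>e. \<theta> \<le> e) (drop k xs) = []"
  proof -
    have "e < \<theta>" if "e \<in> set (drop k xs)" for e
    proof -
      obtain i where i: "i < length (drop k xs)" "e = drop k xs ! i"
        using \<open>e \<in> set (drop k xs)\<close> by (metis in_set_conv_nth)
      then have "xs ! (k + i) \<le> xs ! k"
        using sorted_wrt_nth_less[OF assms(1), of k "k + i"] \<open>k < length xs\<close> by (cases "i = 0") auto
      then show ?thesis using neg i \<open>k < length xs\<close> by simp
    qed
    then show ?thesis by (auto simp: filter_empty_conv not_le)
  qed
  then have "filter (\<lambda>e. \<theta> \<le> e) xs = filter (\<lambda>e. \<theta> \<le> e) (take k xs)"
    by (metis append_take_drop_id filter_append append_Nil2)
  then have "length (filter (\<lambda>e. \<theta> \<le> e) xs) \<le> k"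
    using length_filter_le[of "\<lambda>e. \<theta> \<le> e" "take k xs"] by simp
  then show False using assms(2) by simp
qed

section \<open>Test vectors supported on sets of vertices\<close>

definition adj_form :: "('a \<times> 'a) set \<Rightarrow> 'a set \<Rightarrow> ('a \<Rightarrow> real) \<Rightarrow> real" where
  "adj_form R C y = (\<Sum>u\<in>C. \<Sum>v\<in>C. if (u, v) \<in> R then y u * y v else 0)"

text \<open>For finite \<open>C\<close> and symmetric \<open>R\<close> this says that the 0-1 matrix
  of \<open>R\<close> on \<open>C\<close> has an eigenvalue of at least \<open>\<theta>\<close>. A
  test vector as witness avoids speaking of the spectrum of an induced graph.\<close>

definition rayleigh_ge :: "('a \<times> 'a) set \<Rightarrow> 'a set \<Rightarrow> real \<Rightarrow> bool" where
  "rayleigh_ge R C \<theta> \<longleftrightarrow> (\<exists>y. (\<exists>v\<in>C. y v \<noteq> 0) \<and> \<theta> * (\<Sum>v\<in>C. (y v)\<^sup>2) \<le> adj_form R C y)"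

text \<open>Extended by zero, test vectors of different sets have disjoint supports and are
  orthogonal. As no arcs join the sets, they are orthogonal for the adjacency form as well, and
  \<open>count_eigenvalues_ge\<close> applies.\<close>

theorem graph_eigenvalue_ge_disjoint:
  fixes G :: "('a, 'b) pre_digraph"
  assumes "graph G" and D: "finite \<D>" "\<D> \<noteq> {}" "\<And>C. C \<in> \<D> \<Longrightarrow> C \<subseteq> verts G"
    and disj: "\<And>C C'. C \<in> \<D> \<Longrightarrow> C' \<in> \<D> \<Longrightarrow> C \<noteq> C' \<Longrightarrow> C \<inter> C' = {}"
    and sep: "\<And>C C' u v. C \<in> \<D> \<Longrightarrow> C' \<in> \<D> \<Longrightarrow> C \<noteq> C' \<Longrightarrow> u \<in> C \<Longrightarrow> v \<in> C' \<Longrightarrow> (u, v) \<notin> arcs_ends G"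
    and ray: "\<And>C. C \<in> \<D> \<Longrightarrow> rayleigh_ge (arcs_ends G) C \<theta>"
  shows "\<theta> \<le> graph_eigenvalue G (card \<D>)"
proof -
  interpret graph G by fact
  define vs where "vs = (SOME vs. distinct vs \<and> set vs = verts G)"
  have "distinct vs \<and> set vs = verts G"
    unfolding vs_def by (rule someI_ex) (metis finite_distinct_list finite_verts)
  then have vs: "distinct vs" "set vs = verts G" by auto
  let ?n = "length vs" let ?R = "arcs_ends G"
  define A where "A = adjacency_mat G vs"
  have A: "A \<in> carrier_mat ?n ?n" by (simp add: A_def adjacency_mat_def)
  have Aij: "A $$ (i, j) = (if (vs ! i, vs ! j) \<in> ?R then 1 else 0)" if "i < ?n" "j < ?n" for i j
    using that by (simp add: A_def adjacency_mat_def)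
  have Rsym: "(u, v) \<in> ?R \<longleftrightarrow> (v, u) \<in> ?R" for u v
    using sym_arcs by (auto simp: symmetric_def dest: symD)
  have sym: "transpose_mat A = A"
    by (rule eq_matI) (use A Rsym in \<open>auto simp: Aij\<close>)
  have sum_vs: "(\<Sum>i<?n. h (vs ! i)) = (\<Sum>v\<in>verts G. h v)" for h :: "'a \<Rightarrow> real"
    using sum.reindex_bij_betw[OF bij_betw_nth[OF vs(1) refl refl], of h] vs(2) by simp
  obtain f where f: "bij_betw f {..<card \<D>} \<D>"
    using ex_bij_betw_nat_finite[OF \<open>finite \<D>\<close>] by (auto simp: atLeast0LessThan)
  have fD: "f i \<in> \<D>" if "i < card \<D>" for i using f that by (auto simp: bij_betw_def)
  have fneq: "f i \<noteq> f j" if "i < card \<D>" "j < card \<D>" "i \<noteq> j" for i j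
    using f that by (auto simp: bij_betw_def inj_on_def)
  define Y where "Y C = (SOME y. (\<exists>v\<in>C. y v \<noteq> 0) \<and> \<theta> * (\<Sum>v\<in>C. (y v)\<^sup>2) \<le> adj_form ?R C y)" for C
  have Y: "\<exists>v\<in>C. Y C v \<noteq> 0" "\<theta> * (\<Sum>v\<in>C. (Y C v)\<^sup>2) \<le> adj_form ?R C (Y C)" if "C \<in> \<D>" for C
    using someI_ex[OF ray[OF that, unfolded rayleigh_ge_def]] unfolding Y_def by auto
  define g where "g i v = (if v \<in> f i then Y (f i) v else 0)" for i v
  define x where "x i = vec ?n (\<lambda>j. g i (vs ! j))" for i
  have x: "x i \<in> carrier_vec ?n" for i by (simp add: x_def)
  have prod: "x i \<bullet> x j = (\<Sum>v\<in>verts G. g i v * g j v)" for i j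
    unfolding sum_vs[symmetric] by (simp add: x_def scalar_prod_def atLeast0LessThan)
  have form: "x i \<bullet> (A *\<^sub>v x j) = (\<Sum>u\<in>verts G. \<Sum>v\<in>verts G. if (u, v) \<in> ?R then g i u * g j v else 0)" for i j
  proof -
    have "x i \<bullet> (A *\<^sub>v x j) = (\<Sum>k<?n. g i (vs ! k) * (\<Sum>l<?n. (if (vs ! k, vs ! l) \<in> ?R then 1 else 0) * g j (vs ! l)))"
      using A by (simp add: x_def scalar_prod_def atLeast0LessThan Aij)
    also have "\<dots> = (\<Sum>k<?n. \<Sum>l<?n. if (vs ! k, vs ! l) \<in> ?R then g i (vs ! k) * g j (vs ! l) else 0)"
      unfolding sum_distrib_left by (intro sum.cong refl) auto
    also have "\<dots> = (\<Sum>k<?n. \<Sum>v\<in>verts G. if (vs ! k, v) \<in> ?R then g i (vs ! k) * g j v else 0)"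
      by (intro sum.cong refl sum_vs)
    also have "\<dots> = (\<Sum>u\<in>verts G. \<Sum>v\<in>verts G. if (u, v) \<in> ?R then g i u * g j v else 0)"
      by (rule sum_vs)
    finally show ?thesis .
  qed
  have "card \<D> \<le> size (filter_mset (\<lambda>e. \<theta> \<le> e) (proots (char_poly A)))"
  proof (rule count_eigenvalues_ge[OF A sym x])
    fix i assume i: "i < card \<D>"
    obtain v where v: "v \<in> f i" "Y (f i) v \<noteq> 0" using Y(1)[OF fD[OF i]] by auto
    then have "v \<in> set vs" using D(3)[OF fD[OF i]] vs by auto
    then obtain k where "k < ?n" "v = vs ! k" by (auto simp: in_set_conv_nth)
    then show "x i \<noteq> 0\<^sub>v ?n" using v by (auto simp: x_def g_def dest!: arg_cong[of _ _ "\<lambda>y. y $ k"])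
    have "x i \<bullet> x i = (\<Sum>v\<in>f i. (Y (f i) v)\<^sup>2)"
      unfolding prod by (rule sum.mono_neutral_cong_right)
        (use D(3)[OF fD[OF i]] in \<open>auto simp: g_def power2_eq_square\<close>)
    moreover have "x i \<bullet> (A *\<^sub>v x i) = adj_form ?R (f i) (Y (f i))"
      unfolding form adj_form_def
    proof (rule sum.mono_neutral_cong_right)
      fix u assume u: "u \<in> f i"
      show "(\<Sum>v\<in>verts G. if (u, v) \<in> ?R then g i u * g i v else 0)
          = (\<Sum>v\<in>f i. if (u, v) \<in> ?R then Y (f i) u * Y (f i) v else 0)"
        by (rule sum.mono_neutral_cong_right) (use D(3)[OF fD[OF i]] u in \<open>auto simp: g_def\<close>)
    qed (use D(3)[OF fD[OF i]] in \<open>auto simp: g_def intro!: sum.neutral\<close>)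
    ultimately show "\<theta> * (x i \<bullet> x i) \<le> x i \<bullet> (A *\<^sub>v x i)" using Y(2)[OF fD[OF i]] by simp
  next
    fix i j assume ij: "i < card \<D>" "j < card \<D>" "i \<noteq> j"
    have "f i \<inter> f j = {}" using disj fD fneq ij by simp
    then show "x i \<bullet> x j = 0" unfolding prod by (intro sum.neutral) (auto simp: g_def)
    show "x i \<bullet> (A *\<^sub>v x j) = 0"
      unfolding form
      by (intro sum.neutral ballI) (use sep[OF fD fD fneq, OF ij(1,2,1,2,3)] in \<open>auto simp: g_def\<close>)
  qed
  also have "proots (char_poly A) = graph_spectrum G"
    by (simp add: graph_spectrum_def A_def vs_def)
  also have "filter_mset (\<lambda>e. \<theta> \<le> e) (graph_spectrum G)
      = mset (filter (\<lambda>e. \<theta> \<le> e) (rev (sorted_list_of_multiset (graph_spectrum G))))"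
    by simp
  finally have "card \<D> \<le> length (filter (\<lambda>e. \<theta> \<le> e) (rev (sorted_list_of_multiset (graph_spectrum G))))"
    by (simp only: size_mset)
  \<comment> \<open>List positions start at 0 while \<open>graph_eigenvalue\<close> counts from 1,
    so the position wanted is \<open>card \<D> - 1\<close>.\<close>
  moreover have "0 < card \<D>" using D(1,2) by (simp add: card_gt_0_iff)
  ultimately have "card \<D> - 1 < length (filter (\<lambda>e. \<theta> \<le> e) (rev (sorted_list_of_multiset (graph_spectrum G))))"
    by linarith
  moreover have "sorted_wrt (\<ge>) (rev (sorted_list_of_multiset (graph_spectrum G)))"
    by (simp add: sorted_wrt_rev)
  ultimately show ?thesis unfolding graph_eigenvalue_def by (intro nth_descending_ge)
qed

section \<open>Rayleigh quotients of components\<close>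

text \<open>The handshake lemma on \<open>C\<close>: a new vertex \<open>x\<close> raises the degree
  sum by twice the number of its neighbours in \<open>C\<close>.\<close>

lemma even_sum_degrees:
  assumes "finite C" "sym R" "\<And>v. (v, v) \<notin> R"
  shows "even (\<Sum>v\<in>C. card {w \<in> C. (v, w) \<in> R})"
  using assms(1)
proof (induction C rule: finite_induct)
  case (insert x C)
  have "card {w \<in> insert x C. (v, w) \<in> R} = card {w \<in> C. (v, w) \<in> R} + (if (v, x) \<in> R then 1 else 0)" for v
  proof -
    have "{w \<in> insert x C. (v, w) \<in> R} = (if (v, x) \<in> R then insert x else id) {w \<in> C. (v, w) \<in> R}"
      by auto
    then show ?thesis using insert.hyps by simp
  qed
  moreover have "(\<Sum>v\<in>C. if (v, x) \<in> R then 1 else 0) = card {w \<in> C. (x, w) \<in> R}"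
    using insert.hyps(1) assms(2)
    by (subst sum.inter_filter[symmetric]) (auto intro!: arg_cong[of _ _ card] dest: symD)
  ultimately show ?case using insert.IH insert.hyps assms(3) by (simp add: sum.distrib)
qed simp

text \<open>In the application \<open>e C\<close> counts the edges from a component \<open>C\<close>
  to a cut of \<open>s\<close> vertices. If at most \<open>b\<close> components had
  \<open>e C \<le> d - b\<close>, the others would send out too many edges.\<close>

lemma many_small_values:
  fixes e :: "'c \<Rightarrow> nat"
  assumes "finite \<C>" and pos: "\<And>C. C \<in> \<C> \<Longrightarrow> 1 \<le> e C"
    and sum: "(\<Sum>C\<in>\<C>. e C) \<le> d * s" and card: "b * s < card \<C>" and "1 \<le> b" "1 \<le> s"
  shows "b < d \<and> b + 1 \<le> card {C \<in> \<C>. e C \<le> d - b}"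
proof
  have "card \<C> \<le> (\<Sum>C\<in>\<C>. e C)" using sum_mono[of \<C> "\<lambda>_. 1" e] pos by simp
  then have "b * s < d * s" using sum card by linarith
  then show "b < d" by simp
  define t where "t = d - b"
  have d: "d = b + t" "1 \<le> t" using \<open>b < d\<close> by (auto simp: t_def)
  obtain s' b' where s: "s = Suc s'" "b = Suc b'" using \<open>1 \<le> s\<close> \<open>1 \<le> b\<close>
    by (cases s; cases b) auto
  let ?L = "{C \<in> \<C>. e C \<le> d - b}"
  show "b + 1 \<le> card ?L"
  proof (rule ccontr)
    assume "\<not> ?thesis"
    then have L: "card ?L \<le> b" by simp
    have "(t + 1) * card \<C> = (\<Sum>C\<in>\<C>. t + 1)" by simp
    \<comment> \<open>Small values are at least 1, so adding \<open>t\<close> lifts them to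
      \<open>t + 1\<close>; the other values are that large already.\<close>
    also have "\<dots> \<le> (\<Sum>C\<in>\<C>. e C + (if e C \<le> d - b then t else 0))"
      using pos d by (intro sum_mono) (auto simp: not_le)
    also have "\<dots> = (\<Sum>C\<in>\<C>. e C) + t * card ?L"
      using \<open>finite \<C>\<close> by (simp add: sum.distrib flip: sum.inter_filter)
    also have "\<dots> \<le> d * s + t * b" using sum L by (intro add_mono) auto
    finally have "(t + 1) * card \<C> \<le> d * s + t * b" .
    moreover have "(t + 1) * (b * s + 1) \<le> (t + 1) * card \<C>" using card by (intro mult_le_mono2) simp
    \<comment> \<open>The difference of the two sides is \<open>t * (b - 1) * (s - 1) + 1\<close>;
      writing \<open>b\<close> and \<open>s\<close> as successors avoids truncated
      subtraction.\<close>
    moreover have "d * s + t * b < (t + 1) * (b * s + 1)" by (simp add: d s algebra_simps)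
    ultimately show False by linarith
  qed
qed

section \<open>Lower bounds for Rayleigh quotients on one component\<close>

lemma adj_form_conv:
  assumes "finite C"
  shows "adj_form R C y = (\<Sum>u\<in>C. y u * (\<Sum>v | v \<in> C \<and> (u, v) \<in> R. y v))"
  unfolding adj_form_def
  by (rule sum.cong[OF refl]) (simp add: sum.inter_filter[OF assms] sum_distrib_left if_distrib[of "(*) _"] cong: if_cong)

text \<open>The number of neighbours of \<open>v\<close> outside \<open>C\<close> is \<open>u v\<close>. The test vector \<open>g - u\<close> is the Perron
  vector of the extremal graphs, where \<open>u\<close> takes only the values 0 and 1 and agrees on nonadjacent
  vertices; there all the estimates are equalities.\<close>

lemma rayleigh_ge_deficiency:
  fixes u :: "'a \<Rightarrow> nat" and \<theta> :: real
  assumes C: "finite C" "C \<noteq> {}" and "sym R"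
    and deg: "\<And>v. v \<in> C \<Longrightarrow> card {w \<in> C. (v, w) \<in> R} + u v = d"
    and g: "g = \<theta> + 1 + real (card C) - real d" and ug: "\<And>v. v \<in> C \<Longrightarrow> real (u v) < g"
    and e: "real (\<Sum>v\<in>C. u v) \<le> (real d - \<theta>) * g"
  shows "rayleigh_ge R C \<theta>"
proof -
  let ?n = "real (card C)" let ?e = "\<Sum>v\<in>C. real (u v)" let ?d = "real d"
  let ?N = "\<lambda>v. {w \<in> C. (v, w) \<in> R}"
  define Q where "Q = (\<Sum>v\<in>C. (real (u v))\<^sup>2)"
  define T where "T = (\<Sum>v\<in>C. (real (u v))^3)"
  define y where "y v = g - real (u v)" for v
  define p where "p v w = (if (v, w) \<in> R then 1 else 0 :: real)" for v w
  have deg': "(\<Sum>w\<in>C. p v w) = ?d - real (u v)" if "v \<in> C" for v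
  proof -
    have "(\<Sum>w\<in>C. p v w) = real (card (?N v))"
      using C(1) by (simp add: p_def flip: sum.inter_filter)
    then show ?thesis using deg[OF that] by simp
  qed
  have p_sym: "p v w = p w v" for v w using \<open>sym R\<close> by (auto simp: p_def dest: symD)
  have norm: "(\<Sum>v\<in>C. (y v)\<^sup>2) = ?n * g\<^sup>2 - 2 * g * ?e + Q"
    by (simp add: y_def Q_def power2_diff sum.distrib sum_subtractf sum_distrib_left algebra_simps)
  have lin: "(\<Sum>v\<in>C. \<Sum>w\<in>C. p v w) = ?d * ?n - ?e"
    using deg' by (simp add: sum_subtractf)
  have mixed: "(\<Sum>v\<in>C. \<Sum>w\<in>C. p v w * real (u v)) = ?d * ?e - Q"
  proof -
    have "(\<Sum>v\<in>C. \<Sum>w\<in>C. p v w * real (u v)) = (\<Sum>v\<in>C. (?d - real (u v)) * real (u v))"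
      using deg' by (simp flip: sum_distrib_right)
    then show ?thesis by (simp add: Q_def sum_subtractf sum_distrib_left power2_eq_square algebra_simps)
  qed
  have mixed': "(\<Sum>v\<in>C. \<Sum>w\<in>C. p v w * real (u w)) = ?d * ?e - Q"
    unfolding mixed[symmetric] by (subst sum.swap) (simp add: p_sym)
  \<comment> \<open>Over all pairs the products \<open>u v * u w\<close> sum to the square of
    \<open>?e\<close>. Each \<open>v\<close> lies in \<open>?n - ?d + u v\<close> ordered pairs
    \<open>(v, w)\<close> outside \<open>R\<close>, and their products are bounded by half the sum
    of the squares.\<close>
  have quad: "?e\<^sup>2 - ((?n - ?d) * Q + T) \<le> (\<Sum>v\<in>C. \<Sum>w\<in>C. p v w * (real (u v) * real (u w)))"
  proof -
    have "(\<Sum>v\<in>C. \<Sum>w\<in>C. (1 - p v w) * (real (u v) * real (u w)))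
        \<le> (\<Sum>v\<in>C. \<Sum>w\<in>C. (1 - p v w) * (((real (u v))\<^sup>2 + (real (u w))\<^sup>2) / 2))"
      using sum_squares_bound
      by (intro sum_mono mult_left_mono) (auto simp: p_def field_simps)
    also have "\<dots> = (\<Sum>v\<in>C. \<Sum>w\<in>C. (1 - p v w) * (real (u v))\<^sup>2 / 2 + (1 - p v w) * (real (u w))\<^sup>2 / 2)"
      by (intro sum.cong refl) (simp add: field_simps)
    also have "\<dots> = (\<Sum>v\<in>C. \<Sum>w\<in>C. (1 - p v w) * (real (u v))\<^sup>2) / 2
        + (\<Sum>v\<in>C. \<Sum>w\<in>C. (1 - p v w) * (real (u w))\<^sup>2) / 2"
      by (simp add: sum.distrib sum_divide_distrib)
    also have "(\<Sum>v\<in>C. \<Sum>w\<in>C. (1 - p v w) * (real (u w))\<^sup>2) = (\<Sum>v\<in>C. \<Sum>w\<in>C. (1 - p v w) * (real (u v))\<^sup>2)"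
      by (subst sum.swap) (simp add: p_sym)
    also have "(\<Sum>v\<in>C. \<Sum>w\<in>C. (1 - p v w) * (real (u v))\<^sup>2) = (\<Sum>v\<in>C. (?n - (?d - real (u v))) * (real (u v))\<^sup>2)"
      using deg' by (simp add: sum_subtractf flip: sum_distrib_right)
    also have "\<dots> = (\<Sum>v\<in>C. (?n - ?d + real (u v)) * (real (u v))\<^sup>2)"
      by (simp add: algebra_simps)
    also have "\<dots> = (?n - ?d) * Q + T"
      by (simp add: Q_def T_def sum.distrib sum_distrib_left ring_distribs power2_eq_square power3_eq_cube mult.assoc)
    finally have "(\<Sum>v\<in>C. \<Sum>w\<in>C. (1 - p v w) * (real (u v) * real (u w))) \<le> (?n - ?d) * Q + T" by simp
    moreover have "(\<Sum>v\<in>C. \<Sum>w\<in>C. (1 - p v w) * (real (u v) * real (u w)))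
        = ?e\<^sup>2 - (\<Sum>v\<in>C. \<Sum>w\<in>C. p v w * (real (u v) * real (u w)))"
      by (simp add: left_diff_distrib sum_subtractf power2_eq_square sum_product)
    ultimately show ?thesis by linarith
  qed
  have "adj_form R C y = (\<Sum>v\<in>C. \<Sum>w\<in>C. p v w * (y v * y w))"
    unfolding adj_form_def by (intro sum.cong refl) (simp add: p_def)
  also have "\<dots> = (\<Sum>v\<in>C. \<Sum>w\<in>C. g\<^sup>2 * p v w - g * (p v w * real (u v)) - g * (p v w * real (u w))
      + p v w * (real (u v) * real (u w)))"
    by (intro sum.cong refl) (simp add: y_def algebra_simps power2_eq_square)
  also have "\<dots> = g\<^sup>2 * (?d * ?n - ?e) - 2 * g * (?d * ?e - Q)
      + (\<Sum>v\<in>C. \<Sum>w\<in>C. p v w * (real (u v) * real (u w)))"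
    using lin mixed mixed' by (simp add: sum.distrib sum_subtractf flip: sum_distrib_left)
  finally have form: "g\<^sup>2 * (?d * ?n - ?e) - 2 * g * (?d * ?e - Q) + ?e\<^sup>2 - ((?n - ?d) * Q + T) \<le> adj_form R C y"
    using quad by linarith
  \<comment> \<open>This sums up \<open>u * (u - 1) * (g - u) \<ge> 0\<close>, valid because
    \<open>u\<close> is a natural number below \<open>g\<close>.\<close>
  have slack: "g * ?e \<le> (g + 1) * Q - T"
  proof -
    have "g * real (u v) \<le> (g + 1) * (real (u v))\<^sup>2 - (real (u v))^3" if "v \<in> C" for v
    proof (cases "u v = 0")
      case False
      then have "0 \<le> real (u v) * ((real (u v) - 1) * (g - real (u v)))"
        using ug[OF that] by (intro mult_nonneg_nonneg) auto
      then show ?thesis by (simp add: algebra_simps power2_eq_square power3_eq_cube)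
    qed simp
    then have "(\<Sum>v\<in>C. g * real (u v)) \<le> (\<Sum>v\<in>C. (g + 1) * (real (u v))\<^sup>2 - (real (u v))^3)"
      by (intro sum_mono)
    then show ?thesis by (simp add: Q_def T_def sum_subtractf sum_distrib_left)
  qed
  have "?e \<le> ?n * g" using sum_mono[of C "\<lambda>v. real (u v)" "\<lambda>_. g"] ug by force
  moreover have "?e \<le> (?d - \<theta>) * g" using e by simp
  \<comment> \<open>By the choice of \<open>g\<close>, the product expands to the lower bound for
    \<open>adj_form\<close> minus \<open>\<theta>\<close> times the squared norm, except that
    \<open>g * ?e\<close> stands in place of \<open>(g + 1) * Q - T\<close>.\<close>
  ultimately have "0 \<le> ((?d - \<theta>) * g - ?e) * (?n * g - ?e)" by simp
  also have "\<dots> = g\<^sup>2 * (?d * ?n - ?e) - 2 * g * (?d * ?e) + ?e\<^sup>2 + g * ?e - \<theta> * (?n * g\<^sup>2 - 2 * g * ?e)"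
    unfolding g by (simp add: algebra_simps power2_eq_square)
  also have "\<dots> \<le> g\<^sup>2 * (?d * ?n - ?e) - 2 * g * (?d * ?e) + ?e\<^sup>2 + ((g + 1) * Q - T) - \<theta> * (?n * g\<^sup>2 - 2 * g * ?e)"
    using slack by simp
  also have "\<dots> = g\<^sup>2 * (?d * ?n - ?e) - 2 * g * (?d * ?e - Q) + ?e\<^sup>2 - ((?n - ?d) * Q + T)
      - \<theta> * (?n * g\<^sup>2 - 2 * g * ?e + Q)"
    unfolding g by (simp add: algebra_simps power2_eq_square)
  finally have "\<theta> * (\<Sum>v\<in>C. (y v)\<^sup>2) \<le> adj_form R C y" using form unfolding norm by linarith
  moreover obtain v where "v \<in> C" using C(2) by auto
  then have "\<exists>v\<in>C. y v \<noteq> 0" using ug[of v] by (intro bexI[of _ v]) (auto simp: y_def)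
  ultimately show ?thesis unfolding rayleigh_ge_def by blast
qed

lemma rayleigh_ge_eigenvector:
  assumes "finite C" "\<exists>v\<in>C. y v \<noteq> 0" "\<And>v. v \<in> C \<Longrightarrow> (\<Sum>w | w \<in> C \<and> (v, w) \<in> R. y w) = \<theta> * y v"
  shows "rayleigh_ge R C \<theta>"
proof -
  have "adj_form R C y = (\<Sum>v\<in>C. y v * (\<theta> * y v))"
    unfolding adj_form_conv[OF assms(1)] using assms(3) by (intro sum.cong) auto
  then have "adj_form R C y = \<theta> * (\<Sum>v\<in>C. (y v)\<^sup>2)"
    by (simp add: sum_distrib_left power2_eq_square mult.left_commute)
  then show ?thesis using assms(2) unfolding rayleigh_ge_def by (metis order_refl)
qed

text \<open>The graph induced on \<open>C\<close> is determined: its complement is a path on three vertices with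
  middle vertex \<open>v\<^sub>0\<close> plus a perfect matching of the rest.\<close>

lemma rayleigh_ge_cubic:
  fixes u :: "'a \<Rightarrow> nat" and x :: real
  assumes C: "finite C" "card C = d + 2" and R: "sym R" "\<And>v. (v, v) \<notin> R"
    and deg: "\<And>v. v \<in> C \<Longrightarrow> card {w \<in> C. (v, w) \<in> R} + u v = d"
    and one: "(\<Sum>v\<in>C. u v) = 1" and "2 \<le> d" "1 < x"
    and root: "x ^ 3 - (real d - 2) * x ^ 2 - 2 * real d * x + real d - 1 = 0"
  shows "rayleigh_ge R C x"
proof -
  obtain v0 where v0: "v0 \<in> C" "u v0 = 1" "\<And>v. v \<in> C \<Longrightarrow> v \<noteq> v0 \<Longrightarrow> u v = 0"
    using sum_eq_1_iff[OF C(1), of u] one by auto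
  \<comment> \<open>The neighbourhood of \<open>v\<close> in the complement: two vertices for
    \<open>v0\<close>, one for every other vertex.\<close>
  define N where "N v = {w \<in> C. w \<noteq> v \<and> (v, w) \<notin> R}" for v
  have N_fin: "finite (N v)" for v using C(1) by (simp add: N_def)
  have N_sub: "N v \<subseteq> C" for v by (auto simp: N_def)
  have N_sym: "w \<in> N v \<longleftrightarrow> v \<in> N w" if "v \<in> C" "w \<in> C" for v w
    using R(1) that by (auto simp: N_def dest: symD)
  have split: "C = insert v ({w \<in> C. (v, w) \<in> R} \<union> N v)" if "v \<in> C" for v
    using that by (auto simp: N_def)
  have N_card: "card (N v) = 1 + u v" if "v \<in> C" for v
  proof -
    have "card C = Suc (card {w \<in> C. (v, w) \<in> R} + card (N v))"
      using that C(1) R(2)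
      by (subst split[OF that], subst card_insert_disjoint) (auto simp: N_def intro!: card_Un_disjoint)
    then show ?thesis using C(2) deg[OF that] by linarith
  qed
  have nbr_sum: "(\<Sum>w | w \<in> C \<and> (v, w) \<in> R. y w) = sum y C - y v - sum y (N v)" if "v \<in> C" for v and y :: "'a \<Rightarrow> real"
  proof -
    have "sum y C = y v + ((\<Sum>w | w \<in> C \<and> (v, w) \<in> R. y w) + sum y (N v))"
      using that C(1) R(2)
      by (subst split[OF that], subst sum.insert) (auto simp: N_def intro!: sum.union_disjoint)
    then show ?thesis by simp
  qed
  have v0_N: "v0 \<notin> N v0" by (simp add: N_def)
  \<comment> \<open>A vector constant on \<open>v0\<close>, on \<open>N v0\<close> and on the
    remaining \<open>d - 1\<close> vertices. Its values solve the eigenvector equations at the first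
    two classes; the equation at the third is then the cubic.\<close>
  define y where "y v = (if v = v0 then (real d - 1) * (x - 1) else if v \<in> N v0 then (real d - 1) * x else x * (x - 1))" for v
  have N_v0: "sum y (N v0) = 2 * (real d - 1) * x"
  proof -
    have "sum y (N v0) = (\<Sum>v\<in>N v0. (real d - 1) * x)"
      by (intro sum.cong refl) (use v0_N in \<open>auto simp: y_def\<close>)
    then show ?thesis using N_card[OF v0(1)] v0(2) by simp
  qed
  have total: "sum y C = (real d - 1) * (x - 1) + 2 * (real d - 1) * x + (real d - 1) * (x * (x - 1))"
  proof -
    have "sum y C = sum y (C - insert v0 (N v0)) + sum y (insert v0 (N v0))"
      using C(1) v0(1) N_sub by (intro sum.subset_diff) auto
    also have "sum y (insert v0 (N v0)) = y v0 + sum y (N v0)"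
      using N_fin v0_N by simp
    also have "sum y (C - insert v0 (N v0)) = (\<Sum>v\<in>C - insert v0 (N v0). x * (x - 1))"
      by (intro sum.cong refl) (auto simp: y_def)
    also have "\<dots> = real (card (C - insert v0 (N v0))) * (x * (x - 1))" by simp
    also have "card (C - insert v0 (N v0)) = d - 1"
    proof -
      have "card (insert v0 (N v0)) = 3" using N_card[OF v0(1)] v0(2) N_fin v0_N by simp
      then show ?thesis using C v0(1) N_sub N_fin by (subst card_Diff_subset) auto
    qed
    finally show ?thesis using N_v0 \<open>2 \<le> d\<close> by (simp add: y_def of_nat_diff)
  qed
  have "(\<Sum>w | w \<in> C \<and> (v, w) \<in> R. y w) = x * y v" if v: "v \<in> C" for v
  proof -
    consider "v = v0" | "v \<noteq> v0" "v \<in> N v0" | "v \<noteq> v0" "v \<notin> N v0" by blast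
    then show ?thesis
    proof cases
      case 1
      then show ?thesis using nbr_sum[OF v, of y] total N_v0 by (simp add: y_def algebra_simps)
    next
      case 2
      have "card (N v) = 1" using N_card[OF v] v0(3)[OF v 2(1)] by simp
      moreover have "v0 \<in> N v" using 2 N_sym v v0(1) by blast
      ultimately have "N v = {v0}" by (metis card_1_singletonE singletonD)
      then show ?thesis using nbr_sum[OF v, of y] total 2 by (simp add: y_def algebra_simps)
    next
      case 3
      have "card (N v) = 1" using N_card[OF v] v0(3)[OF v 3(1)] by simp
      then obtain t where t: "N v = {t}" by (metis card_1_singletonE)
      then have tC: "t \<in> C" using N_sub by blast
      have "t \<noteq> v0" using t 3 N_sym v v0(1) by blast
      \<comment> \<open>A vertex of \<open>N v0\<close> has \<open>v0\<close> as its only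
        non-neighbour, so \<open>t\<close> belongs to the same class as \<open>v\<close> and
        \<open>y t = y v\<close>.\<close>
      moreover have "t \<notin> N v0"
      proof
        assume "t \<in> N v0"
        then have "v0 \<in> N t" "v \<in> N t" using N_sym v v0(1) tC t by blast+
        moreover have "card (N t) = 1" using N_card[OF tC] v0(3)[OF tC \<open>t \<noteq> v0\<close>] by simp
        ultimately show False using 3 by (metis card_1_singletonE singletonD)
      qed
      ultimately have "(\<Sum>w | w \<in> C \<and> (v, w) \<in> R. y w) = sum y C - 2 * (x * (x - 1))"
        using nbr_sum[OF v, of y] t 3 by (simp add: y_def)
      moreover have "sum y C - 2 * (x * (x - 1)) - x * (x * (x - 1))
          = - (x ^ 3 - (real d - 2) * x ^ 2 - 2 * real d * x + real d - 1)"
        unfolding total by (simp add: algebra_simps power2_eq_square power3_eq_cube)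
      ultimately show ?thesis using root 3 by (simp add: y_def)
    qed
  qed
  moreover have "y v0 \<noteq> 0" using \<open>2 \<le> d\<close> \<open>1 < x\<close> by (simp add: y_def)
  ultimately show ?thesis using rayleigh_ge_eigenvector[OF C(1), of y R x] v0(1) by blast
qed

section \<open>The thresholds \<open>alpha\<close> and \<open>psi\<close>\<close>

lemma alpha_properties:
  assumes "2 \<le> d"
  shows "alpha d ^ 3 - (real d - 2) * alpha d ^ 2 - 2 * real d * alpha d + real d - 1 = 0"
    and "real d - 1 \<le> alpha d" and "alpha d < real d"
proof -
  define f where "f x = x ^ 3 - (real d - 2) * x ^ 2 - 2 * real d * x + real d - 1" for x :: real
  \<comment> \<open>The \<open>Max\<close> in \<open>alpha\<close> needs a finite nonempty set.
    Finiteness comes from a nonzero polynomial, nonemptiness from a sign change between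
    \<open>d - 1\<close> and \<open>d\<close>.\<close>
  have "finite {x. poly [:real d - 1, - 2 * real d, - (real d - 2), 1:] x = 0}"
    by (rule poly_roots_finite) simp
  moreover have "{x. f x = 0} = {x. poly [:real d - 1, - 2 * real d, - (real d - 2), 1:] x = 0}"
    by (simp add: f_def power2_eq_square power3_eq_cube algebra_simps)
  ultimately have fin: "finite {x. f x = 0}" by simp
  have "f (real d - 1) = - (real d * (real d - 1))" "f (real d) = real d - 1"
    by (simp_all add: f_def power2_eq_square power3_eq_cube algebra_simps)
  then have "f (real d - 1) \<le> 0" "0 \<le> f (real d)" using assms by auto
  then obtain r where r: "real d - 1 \<le> r" "f r = 0"
    using IVT'[of f "real d - 1" 0 "real d"] by (force simp: f_def intro: continuous_intros)
  have alpha: "alpha d = Max {x. f x = 0}" by (simp add: alpha_def f_def)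
  have "alpha d \<in> {x. f x = 0}" unfolding alpha using r by (intro Max_in[OF fin]) auto
  then have root: "f (alpha d) = 0" by simp
  then show "alpha d ^ 3 - (real d - 2) * alpha d ^ 2 - 2 * real d * alpha d + real d - 1 = 0"
    by (simp add: f_def)
  have "r \<le> alpha d" unfolding alpha using r fin by (intro Max_ge) auto
  then show "real d - 1 \<le> alpha d" using r by simp
  show "alpha d < real d"
  proof (rule ccontr)
    assume "\<not> ?thesis"
    then have "0 \<le> (alpha d - real d) * (alpha d * (alpha d + 2))" using assms by simp
    moreover have "f (alpha d) = (alpha d - real d) * (alpha d * (alpha d + 2)) + real d - 1"
      by (simp add: f_def power2_eq_square power3_eq_cube algebra_simps)
    ultimately show False using root assms by simp
  qed
qed

text \<open>The condition \<open>e \<le> (d - \<theta>) * g\<close> of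
  \<open>rayleigh_ge_deficiency\<close> for \<open>\<theta> = alpha d\<close>, \<open>e = 1\<close>
  and \<open>d + 4\<close> vertices, where \<open>g = \<theta> + 5\<close>. Writing the cubic as
  \<open>(d - x) * q = x - 1\<close> reduces it to \<open>x \<ge> 2\<close>.\<close>

lemma alpha_deficiency:
  assumes "3 \<le> d"
  shows "1 \<le> (real d - alpha d) * (alpha d + 5)"
proof -
  define x where "x = alpha d"
  have root: "x ^ 3 - (real d - 2) * x ^ 2 - 2 * real d * x + real d - 1 = 0" and x: "2 \<le> x"
    using alpha_properties[of d] assms by (auto simp: x_def)
  define q where "q = x ^ 2 + 2 * x - 1"
  have q: "0 < q" using x zero_le_power2[of x] unfolding q_def by linarith
  have "(real d - x) * q = x - 1"
    using root by (simp add: q_def power2_eq_square power3_eq_cube algebra_simps)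
  then have "(real d - x) * (x + 5) * q = (x - 1) * (x + 5)" by (metis mult.assoc mult.commute)
  also have "\<dots> = q + (2 * x - 4)" by (simp add: q_def power2_eq_square algebra_simps)
  finally have "1 * q \<le> (real d - x) * (x + 5) * q" using x by simp
  then show ?thesis using q unfolding x_def by (simp only: mult_le_cancel_right_pos)
qed

text \<open>With \<open>m = d\<close> or \<open>m = d + 1\<close> this places \<open>psi d b\<close>
  between \<open>d - 1\<close> and \<open>d\<close>.\<close>

lemma sqrt_bounds:
  fixes m K :: real
  assumes "0 \<le> m" "m ^ 2 \<le> K" "K < (m + 2) ^ 2"
  shows "m \<le> sqrt K" "sqrt K < m + 2" "(sqrt K) ^ 2 = K"
proof -
  show "m \<le> sqrt K" using assms(2) by (rule real_le_rsqrt)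
  show "sqrt K < m + 2" using assms by (intro real_less_lsqrt) auto
  have "0 \<le> K" using assms(2) zero_le_power2[of m] by linarith
  then show "(sqrt K) ^ 2 = K" by simp
qed

text \<open>The last identity is the equality case \<open>e = (d - \<theta>) * g\<close> for
  \<open>d + 1\<close> vertices and \<open>e = d - b\<close>.\<close>

lemma psi_same_parity:
  assumes "b + 2 \<le> d" "even d \<longleftrightarrow> even b"
  shows "real d - 1 \<le> psi d b" "psi d b < real d" "(real d - psi d b) * (psi d b + 2) = real d - real b"
proof -
  define r where "r = sqrt (real d ^ 2 + 4 * real b + 4)"
  have r: "real d \<le> r" "r < real d + 2" "r ^ 2 = real d ^ 2 + 4 * real b + 4"
    unfolding r_def using assms(1)
    by (intro sqrt_bounds[of "real d"]; simp add: power2_eq_square algebra_simps)+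
  have psi: "psi d b = (real d - 2 + r) / 2" using assms by (simp add: psi_def r_def)
  show "real d - 1 \<le> psi d b" "psi d b < real d" using r by (auto simp: psi)
  have "(real d - psi d b) * (psi d b + 2) = ((real d + 2) ^ 2 - r ^ 2) / 4"
    by (simp add: psi power2_eq_square field_simps)
  then show "(real d - psi d b) * (psi d b + 2) = real d - real b"
    unfolding r(3) by (simp add: power2_eq_square algebra_simps)
qed

text \<open>For odd \<open>d\<close>, an odd \<open>e\<close> forces an odd number of vertices,
  hence not \<open>d + 1\<close>. The last identity is the equality case for \<open>d + 2\<close>
  vertices and \<open>e = d - b\<close>.\<close>

lemma psi_odd_even:
  assumes "b + 2 \<le> d" "odd d" "even b"
  shows "real d - 1 \<le> psi d b" "psi d b < real d" "(real d - psi d b) * (psi d b + 3) = real d - real b"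
proof -
  define r where "r = sqrt (real d ^ 2 + 4 * real b + 2 * real d + 9)"
  have r: "real d + 1 \<le> r" "r < real d + 1 + 2" "r ^ 2 = real d ^ 2 + 4 * real b + 2 * real d + 9"
    unfolding r_def using assms(1)
    by (intro sqrt_bounds[of "real d + 1"]; simp add: power2_eq_square algebra_simps)+
  have psi: "psi d b = (real d - 3 + r) / 2" using assms by (simp add: psi_def r_def)
  show "real d - 1 \<le> psi d b" "psi d b < real d" using r by (auto simp: psi)
  have "(real d - psi d b) * (psi d b + 3) = ((real d + 3) ^ 2 - r ^ 2) / 4"
    by (simp add: psi power2_eq_square field_simps)
  then show "(real d - psi d b) * (psi d b + 3) = real d - real b"
    unfolding r(3) by (simp add: power2_eq_square algebra_simps)
qed

text \<open>For even \<open>d\<close> also \<open>e\<close> is even and cannot equal the odd number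
  \<open>d - b\<close>. The last identity is the equality case for \<open>d + 1\<close> vertices and
  \<open>e = d - b - 1\<close>.\<close>

lemma psi_even_odd:
  assumes "b + 2 \<le> d" "even d" "odd b"
  shows "real d - 1 \<le> psi d b" "psi d b < real d" "(real d - psi d b) * (psi d b + 2) = real d - real b - 1"
proof -
  define r where "r = sqrt (real d ^ 2 + 4 * real b + 8)"
  have r: "real d \<le> r" "r < real d + 2" "r ^ 2 = real d ^ 2 + 4 * real b + 8"
    unfolding r_def using assms(1)
    by (intro sqrt_bounds[of "real d"]; simp add: power2_eq_square algebra_simps)+
  have psi: "psi d b = (real d - 2 + r) / 2" using assms by (simp add: psi_def r_def)
  show "real d - 1 \<le> psi d b" "psi d b < real d" using r by (auto simp: psi)
  have "(real d - psi d b) * (psi d b + 2) = ((real d + 2) ^ 2 - r ^ 2) / 4"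
    by (simp add: psi power2_eq_square field_simps)
  then show "(real d - psi d b) * (psi d b + 2) = real d - real b - 1"
    unfolding r(3) by (simp add: power2_eq_square algebra_simps)
qed

lemma rayleigh_ge_psi:
  fixes u :: "'a \<Rightarrow> nat"
  assumes C: "finite C" "C \<noteq> {}" and R: "sym R" "\<And>v. (v, v) \<notin> R"
    and deg: "\<And>v. v \<in> C \<Longrightarrow> card {w \<in> C. (v, w) \<in> R} + u v = d"
    and e: "1 \<le> (\<Sum>v\<in>C. u v)" "(\<Sum>v\<in>C. u v) \<le> d - b" and "1 \<le> b"
  shows "rayleigh_ge R C (psi d b)"
proof -
  define e where "e = (\<Sum>v\<in>C. u v)"
  define n where "n = card C"
  have e1: "1 \<le> e" "e \<le> d - b" using e by (auto simp: e_def)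
  have bd: "b + 1 \<le> d" using e1 by linarith
  have n0: "1 \<le> n" using C by (simp add: n_def Suc_leI card_gt_0_iff)
  \<comment> \<open>With \<open>n \<le> d\<close> vertices, each would have at least
    \<open>d + 1 - n\<close> neighbours outside, so that
    \<open>e \<ge> n * (d + 1 - n) \<ge> d > d - b\<close>.\<close>
  have nd: "d + 1 \<le> n"
  proof (rule ccontr)
    assume "\<not> ?thesis"
    then have "n \<le> d" by simp
    have "d + 1 - n \<le> u v" if "v \<in> C" for v
    proof -
      have "card {w \<in> C. (v, w) \<in> R} \<le> card (C - {v})"
        using C(1) R(2) by (intro card_mono) auto
      then show ?thesis using deg[OF that] that C(1) n0 by (simp add: n_def)
    qed
    then have "n * (d + 1 - n) \<le> e" using sum_mono[of C "\<lambda>_. d + 1 - n" u] by (simp add: e_def n_def)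
    moreover have "d \<le> n * (d + 1 - n)"
    proof -
      obtain a where "d = n + a" using \<open>n \<le> d\<close> le_Suc_ex by blast
      moreover have "a \<le> n * a" using n0 by simp
      ultimately show ?thesis by simp
    qed
    ultimately show False using e1 \<open>1 \<le> b\<close> bd by linarith
  qed
  have "n * d = (\<Sum>v\<in>C. card {w \<in> C. (v, w) \<in> R} + u v)" using deg by (simp add: n_def)
  also have "\<dots> = (\<Sum>v\<in>C. card {w \<in> C. (v, w) \<in> R}) + e" by (simp add: sum.distrib e_def)
  finally have "even (n * d) \<longleftrightarrow> even ((\<Sum>v\<in>C. card {w \<in> C. (v, w) \<in> R}) + e)" by (rule arg_cong)
  then have parity: "even (n * d) \<longleftrightarrow> even e" using even_sum_degrees[OF C(1) R] by simp
  have u_le: "u v \<le> e" if "v \<in> C" for v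
    unfolding e_def using that C(1) by (intro member_le_sum) auto
  \<comment> \<open>At least \<open>k\<close> vertices exist beyond \<open>d + 1\<close>, so
    \<open>g \<ge> \<theta> + 2 + k\<close>. The bound \<open>u v < g\<close> holds because
    \<open>u v \<le> e \<le> d - 1 \<le> \<theta>\<close>.\<close>
  have generic: "rayleigh_ge R C \<theta>"
    if k: "d + 1 + k \<le> n" and \<theta>: "real d - 1 \<le> \<theta>" "\<theta> < real d"
      and e\<theta>: "real e \<le> (real d - \<theta>) * (\<theta> + 2 + real k)" for \<theta> k
  proof (rule rayleigh_ge_deficiency[OF C R(1) deg refl])
    have kn: "real d + 1 + real k \<le> real n" using k by linarith
    show "real (u v) < \<theta> + 1 + real (card C) - real d" if "v \<in> C" for v
      using u_le[OF that] e1 \<open>1 \<le> b\<close> bd kn \<theta>(1) unfolding n_def by linarith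
    have "(real d - \<theta>) * (\<theta> + 2 + real k) \<le> (real d - \<theta>) * (\<theta> + 1 + real n - real d)"
      using \<theta> kn by (intro mult_left_mono) auto
    then show "real (\<Sum>v\<in>C. u v) \<le> (real d - \<theta>) * (\<theta> + 1 + real (card C) - real d)"
      using e\<theta> unfolding e_def n_def by linarith
  qed
  show ?thesis
  \<comment> \<open>As \<open>b + 1 \<le> d\<close>, the \<open>alpha\<close> branch occurs only for
    \<open>d = b + 1\<close>. Then \<open>e = 1\<close> makes \<open>n\<close> and \<open>d\<close>
    odd: either \<open>n = d + 2\<close>, settled by the cubic, or
    \<open>n \<ge> d + 4\<close>.\<close>
  proof (cases "d = b + 1")
    case True
    then have "e = 1" using e1 by simp
    then have odd: "odd n" "odd d" using parity by auto
    then have d3: "3 \<le> d" using True \<open>1 \<le> b\<close> by (cases "d = 2") auto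
    have psi: "psi d b = alpha d" using True by (simp add: psi_def)
    have "n \<noteq> d + 1" using odd by auto
    show ?thesis
    proof (cases "n = d + 2")
      case True
      then show ?thesis
        unfolding psi using deg \<open>e = 1\<close> d3 alpha_properties[of d]
        by (intro rayleigh_ge_cubic[OF C(1) _ R]) (auto simp: n_def e_def)
    next
      case False
      have "n \<noteq> d + 3" using odd by auto
      then have "d + 1 + 3 \<le> n" using nd False \<open>n \<noteq> d + 1\<close> by linarith
      then show ?thesis
        unfolding psi using alpha_properties[of d] alpha_deficiency[OF d3] d3 \<open>e = 1\<close>
        by (intro generic[of 3]) (auto simp: add.commute)
    qed
  next
    case False
    then have db: "b + 2 \<le> d" using bd by simp
    have er: "real e \<le> real d - real b" using e1 bd by linarith
    consider "even d \<longleftrightarrow> even b" | "odd d" "even b" "odd e" | "odd d" "even b" "even e" | "even d" "odd b"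
      by blast
    then show ?thesis
    proof cases
      case 1
      then show ?thesis using psi_same_parity[OF db] er nd by (intro generic[of 0]) auto
    next
      case 2
      then have "n \<noteq> d + 1" using parity by auto
      then show ?thesis using psi_odd_even[OF db] 2 er nd by (intro generic[of 1]) (auto simp: add.assoc)
    next
      case 3
      then have "e \<noteq> d - b" using db by auto
      then have "real e \<le> real d - real b - 1" using e1 bd by linarith
      \<comment> \<open>The threshold is made for \<open>d + 2\<close> vertices. With
        \<open>d + 1\<close> vertices the bound on \<open>e\<close> drops by
        \<open>d - psi d b \<le> 1\<close>, which the parity of \<open>e\<close> makes up
        for.\<close>
      moreover have "(real d - psi d b) * (psi d b + 2) = real d - real b - (real d - psi d b)"
        using psi_odd_even(3)[OF db 3(1,2)] by (simp add: algebra_simps)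
      ultimately show ?thesis using psi_odd_even(1,2)[OF db 3(1,2)] nd by (intro generic[of 0]) auto
    next
      case 4
      then have "e \<noteq> d - b" using parity bd by auto
      then have "real e \<le> real d - real b - 1" using e1 bd by linarith
      then show ?thesis using psi_even_odd[OF db 4] nd by (intro generic[of 0]) auto
    qed
  qed
qed

section \<open>Components after deleting vertices\<close>

lemma (in digraph) card_neighbours: "card {w. v \<rightarrow>\<^bsub>G\<^esub> w} = out_degree G v"
proof -
  have "inj_on (head G) (out_arcs G v)"
    using no_multi_arcs by (auto simp: inj_on_def arc_to_ends_def)
  moreover have "{w. v \<rightarrow>\<^bsub>G\<^esub> w} = head G ` out_arcs G v" by (auto simp: arcs_ends_conv)
  ultimately show ?thesis by (simp add: card_image out_degree_def)
qed

lemma (in wf_digraph) dominates_induce_iff: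
  "u \<rightarrow>\<^bsub>G \<restriction> W\<^esub> v \<longleftrightarrow> u \<rightarrow>\<^bsub>G\<^esub> v \<and> u \<in> W \<and> v \<in> W"
  by (auto simp: arcs_ends_conv)

lemma (in wf_digraph) num_components_induce:
  "num_components (G \<restriction> W) = card (pre_digraph.sccs_verts (G \<restriction> W))"
proof -
  interpret H: wf_digraph "G \<restriction> W" by (rule wellformed_induce_subgraph)
  show ?thesis by (simp add: num_components_def H.card_sccs_verts)
qed

text \<open>Deleting all vertices but two nonadjacent ones leaves two components.\<close>

lemma (in graph) vertex_cut_exists:
  assumes "\<not> complete_digraph (card (verts G)) G"
  shows "\<exists>S. vertex_cut G S"
proof -
  have "arcs_ends G \<subseteq> {(u, v). (u, v) \<in> verts G \<times> verts G \<and> u \<noteq> v}"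
    using adj_not_same adj_in_verts by auto
  moreover have "graph G" by unfold_locales
  ultimately obtain u v where uv: "u \<in> verts G" "v \<in> verts G" "u \<noteq> v" "\<not> u \<rightarrow>\<^bsub>G\<^esub> v"
    using assms by (auto simp: complete_digraph_def)
  let ?H = "G \<restriction> {u, v}"
  interpret H: wf_digraph ?H by (rule wellformed_induce_subgraph)
  have "\<not> v \<rightarrow>\<^bsub>G\<^esub> u" using uv(4) arcs_ends_symmetric[OF sym_arcs] by blast
  then have "arcs_ends ?H = {}"
    using uv(4) adj_not_same by (auto simp: dominates_induce_iff)
  then have reach: "x \<rightarrow>\<^sup>*\<^bsub>?H\<^esub> y \<longleftrightarrow> x = y \<and> x \<in> {u, v}" for x y
    by (auto simp: H.reachable_conv)
  have "{{u}, {v}} \<subseteq> H.sccs_verts"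
    by (auto simp: H.in_sccs_verts_conv_reachable reach)
  moreover have "finite H.sccs_verts"
    by (rule finite_subset[of _ "Pow {u, v}"]) (use H.sccs_verts_subsets in force)+
  ultimately have "card {{u}, {v}} \<le> card H.sccs_verts" by (intro card_mono)
  then have "2 \<le> num_components ?H" using uv(3) by (simp add: num_components_induce)
  moreover have "verts G - (verts G - {u, v}) = {u, v}" using uv by auto
  ultimately show ?thesis
    by (intro exI[of _ "verts G - {u, v}"]) (simp add: vertex_cut_def delete_verts_def)
qed

lemma (in graph) connected_cut_arc:
  assumes "Digraph_Component.connected G" "p \<in> C" "p \<in> verts G" "q \<notin> C" "q \<in> verts G"
  shows "\<exists>x\<in>C. \<exists>y. y \<notin> C \<and> x \<rightarrow>\<^bsub>G\<^esub> y"
proof -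
  have "p \<rightarrow>\<^sup>*\<^bsub>mk_symmetric G\<^esub> q"
    using assms by (auto simp: Digraph_Component.connected_def)
  then have "p \<rightarrow>\<^sup>*\<^bsub>G\<^esub> q" using reachable_mk_symmetric_eq[OF sym_arcs] by simp
  then have "p \<in> C \<longrightarrow> q \<notin> C \<longrightarrow> (\<exists>x\<in>C. \<exists>y. y \<notin> C \<and> x \<rightarrow>\<^bsub>G\<^esub> y)"
    by (induction rule: reachable_induct) auto
  then show ?thesis using assms by simp
qed

lemma (in graph) num_components_le_of_eigenvalue:
  assumes conn: "Digraph_Component.connected G" and reg: "regular d G" and "1 \<le> b"
    and ev: "graph_eigenvalue G (b + 1) < psi d b" and cut: "vertex_cut G S"
  shows "num_components (delete_verts G S) \<le> b * card S"
proof (rule ccontr)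
  assume neg: "\<not> ?thesis"
  let ?W = "verts G - S" let ?R = "arcs_ends G"
  define \<C> where "\<C> = pre_digraph.sccs_verts (G \<restriction> ?W)"
  interpret H: wf_digraph "G \<restriction> ?W" by (rule wellformed_induce_subgraph)
  have num: "num_components (delete_verts G S) = card \<C>"
    by (simp add: delete_verts_def num_components_induce \<C>_def)
  have many: "b * card S < card \<C>" and two: "2 \<le> card \<C>" and S: "S \<subseteq> verts G"
    using neg cut by (auto simp: num vertex_cut_def)
  have finS: "finite S" using S finite_subset finite_verts by blast
  have R: "sym ?R" "\<And>v. (v, v) \<notin> ?R"
    using sym_arcs adj_not_same by (auto simp: symmetric_def)
  have C_sub: "C \<subseteq> ?W" if "C \<in> \<C>" for C
    using H.sccs_verts_subsets that by (force simp: \<C>_def)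
  have fin\<C>: "finite \<C>" by (rule finite_subset[of _ "Pow ?W"]) (use C_sub in auto)
  have C_fin: "finite C" if "C \<in> \<C>" for C using C_sub[OF that] by (rule finite_subset) simp
  have C_ne: "C \<noteq> {}" if "C \<in> \<C>" for C
    using that by (simp add: \<C>_def H.in_sccs_verts_conv_reachable)
  have C_disj: "C \<inter> C' = {}" if "C \<in> \<C>" "C' \<in> \<C>" "C \<noteq> C'" for C C'
    using H.sccs_verts_disjoint that by (simp add: \<C>_def)
  \<comment> \<open>Arcs come in opposite pairs, so the ends of an arc of \<open>G - S\<close> reach
    each other and lie in the same component.\<close>
  have C_closed: "w \<in> C" if C: "C \<in> \<C>" and vw: "v \<in> C" "v \<rightarrow>\<^bsub>G\<^esub> w" "w \<notin> S" for C v w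
  proof (rule ccontr)
    assume "w \<notin> C"
    have "v \<in> ?W" "w \<in> ?W" using C_sub[OF C] vw adj_in_verts by auto
    moreover have "w \<rightarrow>\<^bsub>G\<^esub> v" using vw arcs_ends_symmetric[OF sym_arcs] by blast
    ultimately have "v \<rightarrow>\<^sup>*\<^bsub>G \<restriction> ?W\<^esub> w" "w \<rightarrow>\<^sup>*\<^bsub>G \<restriction> ?W\<^esub> v"
      using vw by (auto intro!: H.reachable_adjI simp: dominates_induce_iff)
    then show False using C vw(1) \<open>w \<notin> C\<close> by (auto simp: \<C>_def H.in_sccs_verts_conv_reachable)
  qed
  have C_cover: "\<Union>\<C> = ?W"
  proof
    show "?W \<subseteq> \<Union>\<C>"
      using H.scc_of_in_sccs_verts H.in_scc_of_self by (fastforce simp: \<C>_def)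
  qed (use C_sub in auto)
  define u where "u v = card {w \<in> S. v \<rightarrow>\<^bsub>G\<^esub> w}" for v
  have degree: "card {w. v \<rightarrow>\<^bsub>G\<^esub> w} = d" if "v \<in> verts G" for v
    using reg that by (simp add: card_neighbours regular_def)
  have deg: "card {w \<in> C. v \<rightarrow>\<^bsub>G\<^esub> w} + u v = d" if C: "C \<in> \<C>" and v: "v \<in> C" for C v
  proof -
    have split: "{w. v \<rightarrow>\<^bsub>G\<^esub> w} = {w \<in> C. v \<rightarrow>\<^bsub>G\<^esub> w} \<union> {w \<in> S. v \<rightarrow>\<^bsub>G\<^esub> w}"
      using C_closed[OF C v] by auto
    have card_split: "card ({w \<in> C. v \<rightarrow>\<^bsub>G\<^esub> w} \<union> {w \<in> S. v \<rightarrow>\<^bsub>G\<^esub> w}) = card {w \<in> C. v \<rightarrow>\<^bsub>G\<^esub> w} + u v"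
      unfolding u_def using C_fin[OF C] finS C_sub[OF C] by (intro card_Un_disjoint) auto
    have "v \<in> verts G" using C_sub[OF C] v by auto
    from degree[OF this, unfolded split card_split] show ?thesis .
  qed
  define e where "e C = (\<Sum>v\<in>C. u v)" for C
  \<comment> \<open>A second component exists, so by connectedness some arc leaves \<open>C\<close>;
    by \<open>C_closed\<close> it ends in \<open>S\<close>.\<close>
  have e_pos: "1 \<le> e C" if C: "C \<in> \<C>" for C
  proof -
    have "\<C> \<noteq> {C}" using two by auto
    then obtain C' where C': "C' \<in> \<C>" "C' \<noteq> C" using C by auto
    obtain p q where pq: "p \<in> C" "q \<in> C'" using C_ne C C' by blast
    then have "p \<in> verts G" "q \<in> verts G" using C_sub[OF C] C_sub[OF C'(1)] by auto
    moreover have "q \<notin> C" using C_disj[OF C C'(1)] C'(2) pq by auto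
    ultimately obtain x y where xy: "x \<in> C" "y \<notin> C" "x \<rightarrow>\<^bsub>G\<^esub> y"
      using connected_cut_arc[OF conn pq(1)] by blast
    then have "y \<in> S" using C_closed[OF C] by blast
    then have "1 \<le> u x" unfolding u_def using xy finS by (auto simp: Suc_le_eq card_gt_0_iff)
    also have "u x \<le> e C" unfolding e_def using xy C_fin[OF C] by (intro member_le_sum) auto
    finally show ?thesis .
  qed
  \<comment> \<open>Double counting of the edges between \<open>S\<close> and the rest: each vertex
    of \<open>S\<close> accounts for at most \<open>d\<close> of them.\<close>
  have "(\<Sum>C\<in>\<C>. e C) = (\<Sum>v\<in>?W. u v)"
    unfolding e_def C_cover[symmetric] using C_fin C_disj by (intro sum.Union_disjoint[symmetric, unfolded comp_def]) auto
  also have "\<dots> = (\<Sum>v\<in>?W. \<Sum>w\<in>S. if v \<rightarrow>\<^bsub>G\<^esub> w then 1 else 0)"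
    unfolding u_def using finS by (simp flip: sum.inter_filter)
  also have "\<dots> = (\<Sum>w\<in>S. card {v \<in> ?W. v \<rightarrow>\<^bsub>G\<^esub> w})"
    by (subst sum.swap) (simp flip: sum.inter_filter)
  also have "\<dots> \<le> (\<Sum>w\<in>S. d)"
  proof (rule sum_mono)
    fix w assume "w \<in> S"
    have "finite {v. w \<rightarrow>\<^bsub>G\<^esub> v}" by (rule finite_subset[of _ "verts G"]) (auto simp: adj_in_verts)
    then have "card {v \<in> ?W. v \<rightarrow>\<^bsub>G\<^esub> w} \<le> card {v. w \<rightarrow>\<^bsub>G\<^esub> v}"
      using arcs_ends_symmetric[OF sym_arcs] by (intro card_mono) auto
    then show "card {v \<in> ?W. v \<rightarrow>\<^bsub>G\<^esub> w} \<le> d" using degree \<open>w \<in> S\<close> S by auto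
  qed
  finally have e_sum: "(\<Sum>C\<in>\<C>. e C) \<le> d * card S" by (simp add: mult.commute)
  have "card S \<noteq> 0"
  proof
    assume "card S = 0"
    then have "(\<Sum>C\<in>\<C>. e C) = 0" using e_sum by simp
    then show False using e_pos two fin\<C> by force
  qed
  then have small: "b + 1 \<le> card {C \<in> \<C>. e C \<le> d - b}"
    using many_small_values[OF fin\<C> e_pos e_sum many \<open>1 \<le> b\<close>] by simp
  \<comment> \<open>Exactly \<open>b + 1\<close> components are kept, to match the index of the
    eigenvalue in the hypothesis.\<close>
  obtain \<D> where \<D>: "\<D> \<subseteq> {C \<in> \<C>. e C \<le> d - b}" "card \<D> = b + 1"
    using obtain_subset_with_card_n[OF small] by metis
  then have sub: "C \<in> \<C>" "e C \<le> d - b" if "C \<in> \<D>" for C using that by auto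
  have "psi d b \<le> graph_eigenvalue G (card \<D>)"
  proof (rule graph_eigenvalue_ge_disjoint)
    show "graph G" by unfold_locales
    show "finite \<D>" "\<D> \<noteq> {}" using \<D>(2) by (auto intro: card_ge_0_finite)
    show "C \<subseteq> verts G" if "C \<in> \<D>" for C using C_sub sub that by blast
    show "C \<inter> C' = {}" if "C \<in> \<D>" "C' \<in> \<D>" "C \<noteq> C'" for C C'
      using C_disj sub that by blast
    show "\<not> v \<rightarrow>\<^bsub>G\<^esub> w" if "C \<in> \<D>" "C' \<in> \<D>" "C \<noteq> C'" "v \<in> C" "w \<in> C'" for C C' v w
      using C_closed[of C v w] C_disj[of C C'] C_sub[of C'] sub that by blast
    show "rayleigh_ge ?R C (psi d b)" if "C \<in> \<D>" for C
      using rayleigh_ge_psi[OF C_fin C_ne R deg _ _ \<open>1 \<le> b\<close>, of C] sub[OF that] e_pos[of C]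
      by (simp add: e_def)
  qed
  then show False using ev \<D>(2) by simp
qed

theorem theorem1p4:
  fixes G :: "('a, 'b) pre_digraph" and d b :: nat
  assumes "d \<ge> 1" and "b \<ge> 1"
    and "graph G" and "Digraph_Component.connected G" and "regular d G"
    and "graph_eigenvalue G (b + 1) < psi d b"
  shows "tough (1 / real b) G"
proof (cases "complete_digraph (card (verts G)) G")
  case False
  interpret graph G by fact
  let ?T = "{real (card S) / real (num_components (delete_verts G S)) | S. vertex_cut G S}"
  \<comment> \<open>On a finite nonempty set, bounding \<open>Min\<close> from below means bounding
    every element; nonemptiness is where non-completeness enters.\<close>
  have "finite {S. vertex_cut G S}"
    by (rule finite_subset[of _ "Pow (verts G)"]) (auto simp: vertex_cut_def)
  then have "finite ?T" by simp
  moreover have "?T \<noteq> {}" using vertex_cut_exists[OF False] by auto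
  moreover have "1 / real b \<le> x" if x_T: "x \<in> ?T" for x
  proof -
    obtain S where S: "vertex_cut G S" and x: "x = real (card S) / real (num_components (delete_verts G S))"
      using x_T by auto
    let ?c = "num_components (delete_verts G S)"
    have "0 < ?c" using S by (simp add: vertex_cut_def)
    moreover have "?c \<le> b * card S"
      using num_components_le_of_eigenvalue[OF assms(4,5,2,6) S] .
    then have "real ?c \<le> real b * real (card S)" by (metis of_nat_le_iff of_nat_mult)
    ultimately show ?thesis unfolding x using assms(2) by (simp add: field_simps)
  qed
  ultimately show ?thesis unfolding tough_def toughness_def by simp
qed (simp add: tough_def)

end
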